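(* Every separable operator space has the $n$-isometric Lipschitz-lifting property for all $n\in\mathbb{N}$. That is, for every separable operator space $X$ and every $n\in\mathbb{N}$ there exists a linear $n$-contraction $T:X\to\mathcal{F}^n(X)$ such that $\beta_X^n\circ T=\mathrm{Id}_X$.
   Context: Operator spaces are closed linear subspaces of $\mathcal{B}(H)$, $H$ a complex Hilbert space, and linear means $\mathbb{C}$-linear; $\mathrm{M}_n(X)$ has the norm inherited from $\mathcal{B}(H^{\oplus n})$ ($H^{\oplus n}$ the $\ell_2$-sum). For a map $f$, its $n$-th amplification is $f_n([x_{ij}])=[f(x_{ij})]$, and $\mathrm{Lip}_n(f)$ is the Lipschitz constant of $f_n$. A linear map $u$ between operator spaces is an $n$-contraction if $\|u_n\|\le 1$. For an operator space $X$ (pointed at $0$), $\mathrm{Lip}_0(X,\mathbb{C})$ is the space of Lipschitz maps $f:X\to\mathbb{C}$ with $f(0)=0$. $\mathrm{Lip}_0^n(X,\mathbb{C})$ denotes this space with norm $\|f\|_{\mathrm{Lip},n}=\mathrm{Lip}_n(f)$ and operator space structure given, for $[f_{ij}]\in \mathrm{M}_k(\mathrm{Lip}_0(X,\mathbb{C}))$, by $\|[f_{ij}]\|_{\mathrm{Lip},n,k}=\mathrm{Lip}_n\big([f_{ij}]:X\to \mathrm{M}_k\big)$, where $[f_{ij}]$ is viewed as the map $x\mapsto[f_{ij}(x)]$. The dual $E^*$ of an operator space $E$ is an operator space via $\mathrm{M}_k(E^* )\cong\mathrm{CB}(E,\mathrm{M}_k)$. For $x\in X$, $\delta_x\in\mathrm{Lip}_0^n(X,\mathbb{C})^*$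 is $\delta_x(f)=f(x)$, and the $n$-Lipschitz-free operator space is $\mathcal{F}^n(X)=\overline{\mathrm{span}}\{\delta_x:x\in X\}\subset\mathrm{Lip}_0^n(X,\mathbb{C})^*$ with the inherited operator space structure. $\beta_X^n:\mathcal{F}^n(X)\to X$ is the unique bounded linear map with $\beta_X^n\big(\sum_i a_i\delta_{x_i}\big)=\sum_i a_i x_i$ for all finite families $a_i\in\mathbb{C}$, $x_i\in X$ (it is well defined and completely contractive). *)

theory Defs
  imports "HOL-Analysis.Analysis" "HOL-Library.Function_Algebras"
begin

class scaleC =
  fixes scaleC :: "complex \<Rightarrow> 'a \<Rightarrow> 'a"  (infixr \<open>*\<^sub>C\<close> 75)

text \<open>Complex Hilbert spaces; the inner product is linear in its first argument. The axiom
  \<open>cinner_self\<close> contains positive definiteness, since the norm is a norm.\<close>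

class complex_hilbert = banach + scaleC +
  fixes cinner :: "'a \<Rightarrow> 'a \<Rightarrow> complex"
  assumes scaleC_add_right: "c *\<^sub>C (x + y) = c *\<^sub>C x + c *\<^sub>C y"
    and scaleC_add_left: "(c + d) *\<^sub>C x = c *\<^sub>C x + d *\<^sub>C x"
    and scaleC_scaleC: "c *\<^sub>C d *\<^sub>C x = (c * d) *\<^sub>C x"
    and scaleR_scaleC: "r *\<^sub>R x = complex_of_real r *\<^sub>C x"
    and cinner_commute: "cinner x y = cnj (cinner y x)"
    and cinner_add_left: "cinner (x + y) z = cinner x z + cinner y z"
    and cinner_scaleC_left: "cinner (c *\<^sub>C x) y = c * cinner x y"
    and cinner_self: "cinner x x = complex_of_real ((norm x)\<^sup>2)"

lemma norm_scaleC: "norm (c *\<^sub>C x) = cmod c * norm (x :: 'a::complex_hilbert)"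
proof -
  have "complex_of_real ((norm (c *\<^sub>C x))\<^sup>2) = cinner (c *\<^sub>C x) (c *\<^sub>C x)"
    by (simp add: cinner_self)
  also have "\<dots> = c * cnj (cinner (c *\<^sub>C x) x)"
    by (simp only: cinner_scaleC_left cinner_commute [of x "c *\<^sub>C x"])
  also have "\<dots> = c * cnj c * complex_of_real ((norm x)\<^sup>2)"
    by (simp add: cinner_scaleC_left cinner_self del: of_real_power)
  also have "\<dots> = complex_of_real ((cmod c * norm x)\<^sup>2)"
    by (simp only: complex_norm_square [symmetric] power_mult_distrib of_real_mult)
  finally have "(norm (c *\<^sub>C x))\<^sup>2 = (cmod c * norm x)\<^sup>2"
    by (simp only: of_real_eq_iff)
  then show ?thesis
    by simp
qed

instantiation complex :: complex_hilbert
begin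

definition "c *\<^sub>C (z :: complex) = c * z"
definition "cinner z (w :: complex) = z * cnj w"

instance
proof
  fix z w v c d :: complex and r :: real
  show "c *\<^sub>C (z + w) = c *\<^sub>C z + c *\<^sub>C w" "(c + d) *\<^sub>C z = c *\<^sub>C z + d *\<^sub>C z"
    "c *\<^sub>C d *\<^sub>C z = (c * d) *\<^sub>C z" "r *\<^sub>R z = complex_of_real r *\<^sub>C z"
    by (simp_all add: scaleC_complex_def distrib_left distrib_right scaleR_conv_of_real)
  show "cinner z w = cnj (cinner w z)" "cinner (z + w) v = cinner z v + cinner w v"
    "cinner (c *\<^sub>C z) w = c * cinner z w"
    by (simp_all add: cinner_complex_def scaleC_complex_def distrib_right)
  show "cinner z z = complex_of_real ((norm z)\<^sup>2)"
    unfolding cinner_complex_def by (rule complex_norm_square [symmetric])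
qed

end

instantiation "fun" :: (type, scaleC) scaleC
begin

definition "c *\<^sub>C f = (\<lambda>x. c *\<^sub>C f x)"

instance ..

end

instantiation blinfun :: (real_normed_vector, complex_hilbert) scaleC
begin

lift_definition scaleC_blinfun :: "complex \<Rightarrow> 'a \<Rightarrow>\<^sub>L 'b \<Rightarrow> 'a \<Rightarrow>\<^sub>L 'b"
  is "\<lambda>c f x. c *\<^sub>C f x"
proof -
  fix c :: complex and f :: "'a \<Rightarrow> 'b"
  assume f: "bounded_linear f"
  obtain K where K: "\<And>x. norm (f x) \<le> norm x * K"
    using bounded_linear.bounded [OF f] by blast
  show "bounded_linear (\<lambda>x. c *\<^sub>C f x)"
  proof (rule bounded_linear_intro)
    show "c *\<^sub>C f (x + y) = c *\<^sub>C f x + c *\<^sub>C f y" for x y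
      by (simp add: linear_add [OF bounded_linear.linear [OF f]] scaleC_add_right)
    show "c *\<^sub>C f (r *\<^sub>R x) = r *\<^sub>R c *\<^sub>C f x" for r x
      by (simp add: linear_scale [OF bounded_linear.linear [OF f]] scaleR_scaleC
          scaleC_scaleC mult.commute)
    show "norm (c *\<^sub>C f x) \<le> norm x * (cmod c * K)" for x
      using mult_left_mono [OF K [of x], of "cmod c"]
      by (simp add: norm_scaleC algebra_simps)
  qed
qed

instance ..

end

definition clinear_on :: "'a::{plus,scaleC} set \<Rightarrow> ('a \<Rightarrow> 'b::{plus,scaleC}) \<Rightarrow> bool" where
  "clinear_on S u \<longleftrightarrow>
     (\<forall>x\<in>S. \<forall>y\<in>S. u (x + y) = u x + u y) \<and> (\<forall>c. \<forall>x\<in>S. u (c *\<^sub>C x) = c *\<^sub>C u x)"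

text \<open>\<open>'h \<Rightarrow>\<^sub>L 'h\<close> consists of the bounded real-linear operators, so \<open>\<complex>\<close>-linearity is imposed
  separately; the operator norm does not depend on the scalar field.\<close>

definition operator_space :: "('h::complex_hilbert \<Rightarrow>\<^sub>L 'h) set \<Rightarrow> bool" where
  "operator_space X \<longleftrightarrow>
     (\<forall>A\<in>X. clinear_on UNIV (blinfun_apply A)) \<and>
     0 \<in> X \<and> (\<forall>A\<in>X. \<forall>B\<in>X. A + B \<in> X) \<and> (\<forall>c. \<forall>A\<in>X. c *\<^sub>C A \<in> X) \<and> closed X"

text \<open>An \<open>n \<times> n\<close> matrix is a function of two indices of which only the values at indices \<open>< n\<close>
  matter.\<close>

definition mats :: "nat \<Rightarrow> 'e set \<Rightarrow> (nat \<Rightarrow> nat \<Rightarrow> 'e) set" where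
  "mats n E = {a. \<forall>i<n. \<forall>j<n. a i j \<in> E}"

text \<open>Norm of a matrix of bounded operators, indexed by a finite set \<open>I\<close>, as an operator on the
  \<open>\<ell>\<^sub>2\<close>-sum of \<open>I\<close> copies of \<open>'h\<close>.\<close>

definition mat_norm :: "'i set \<Rightarrow> ('i \<Rightarrow> 'i \<Rightarrow> 'h::real_normed_vector \<Rightarrow> 'h) \<Rightarrow> real" where
  "mat_norm I A =
     (SUP \<xi>\<in>{\<xi>. (\<Sum>i\<in>I. (norm (\<xi> i))\<^sup>2) \<le> 1}. sqrt (\<Sum>i\<in>I. (norm (\<Sum>j\<in>I. A i j (\<xi> j)))\<^sup>2))"

text \<open>Norm of the element \<open>[[a i j p q]\<^sub>p\<^sub>q]\<^sub>i\<^sub>j\<close> of \<open>M\<^sub>m(M\<^sub>k)\<close>, i.e. of a scalar matrix with index set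
  \<open>{..<m} \<times> {..<k}\<close>.\<close>

definition block_norm :: "nat \<Rightarrow> nat \<Rightarrow> (nat \<Rightarrow> nat \<Rightarrow> nat \<Rightarrow> nat \<Rightarrow> complex) \<Rightarrow> real" where
  "block_norm m k a = mat_norm ({..<m} \<times> {..<k}) (\<lambda>(i, p) (j, q) z. a i j p q * z)"

type_synonym 'e matrix_norms = "nat \<Rightarrow> (nat \<Rightarrow> nat \<Rightarrow> 'e) \<Rightarrow> ennreal"

definition op_mnorm :: "('h::complex_hilbert \<Rightarrow>\<^sub>L 'h) matrix_norms" where
  "op_mnorm n x = ennreal (mat_norm {..<n} (\<lambda>i j. blinfun_apply (x i j)))"

definition n_contraction ::
  "'e::{plus,scaleC} set \<Rightarrow> 'e matrix_norms \<Rightarrow> 'f::{plus,scaleC} matrix_norms \<Rightarrow> nat \<Rightarrow>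
   ('e \<Rightarrow> 'f) \<Rightarrow> bool" where
  "n_contraction E N N' n u \<longleftrightarrow>
     clinear_on E u \<and> (\<forall>x\<in>mats n E. N' n (\<lambda>i j. u (x i j)) \<le> N n x)"

text \<open>Dual of an operator space with carrier \<open>E\<close> and matrix norms \<open>N\<close>: functionals are set to 0
  outside \<open>E\<close>, and \<open>[\<phi>\<^sub>p\<^sub>q] \<in> M\<^sub>k(E\<^sup>*)\<close> has the completely bounded norm of \<open>e \<mapsto> [\<phi>\<^sub>p\<^sub>q(e)]\<close>, \<open>E \<rightarrow> M\<^sub>k\<close>.\<close>

definition dual :: "'e::{plus,scaleC} set \<Rightarrow> 'e matrix_norms \<Rightarrow> ('e \<Rightarrow> complex) set" where
  "dual E N = {\<phi>. clinear_on E \<phi> \<and> (\<forall>e. e \<notin> E \<longrightarrow> \<phi> e = 0) \<and>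
     (\<exists>C. \<forall>e\<in>E. ennreal (cmod (\<phi> e)) \<le> ennreal C * N 1 (\<lambda>_ _. e))}"

definition dual_mnorm :: "'e set \<Rightarrow> 'e matrix_norms \<Rightarrow> ('e \<Rightarrow> complex) matrix_norms" where
  "dual_mnorm E N k \<phi> =
     (SUP m. SUP e\<in>{e \<in> mats m E. N m e \<le> 1}. ennreal (block_norm m k (\<lambda>i j p q. \<phi> p q (e i j))))"

text \<open>Functions on \<open>X\<close> are set to 0 outside \<open>X\<close>.\<close>

definition Lip0 :: "('h::complex_hilbert \<Rightarrow>\<^sub>L 'h) set \<Rightarrow> (('h \<Rightarrow>\<^sub>L 'h) \<Rightarrow> complex) set" where
  "Lip0 X = {f. (\<exists>L. L-lipschitz_on X f) \<and> f 0 = 0 \<and> (\<forall>x. x \<notin> X \<longrightarrow> f x = 0)}"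

text \<open>\<open>Lip\<^sub>n\<close> of the map \<open>x \<mapsto> [f\<^sub>p\<^sub>q(x)]\<close>, \<open>X \<rightarrow> M\<^sub>k\<close>. Pairs of equal matrices contribute \<open>0 / 0 = 0\<close>.\<close>

definition Lip_mnorm ::
  "nat \<Rightarrow> ('h::complex_hilbert \<Rightarrow>\<^sub>L 'h) set \<Rightarrow> (('h \<Rightarrow>\<^sub>L 'h) \<Rightarrow> complex) matrix_norms" where
  "Lip_mnorm n X k f =
     (SUP x\<in>mats n X. SUP y\<in>mats n X.
        ennreal (block_norm n k (\<lambda>i j p q. f p q (x i j) - f p q (y i j)) /
                 mat_norm {..<n} (\<lambda>i j. blinfun_apply (x i j - y i j))))"

definition evaluation ::
  "('h::complex_hilbert \<Rightarrow>\<^sub>L 'h) set \<Rightarrow> ('h \<Rightarrow>\<^sub>L 'h) \<Rightarrow> (('h \<Rightarrow>\<^sub>L 'h) \<Rightarrow> complex) \<Rightarrow> complex" where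
  "evaluation X x = (\<lambda>f. if f \<in> Lip0 X then f x else 0)"

definition free_mnorm ::
  "nat \<Rightarrow> ('h::complex_hilbert \<Rightarrow>\<^sub>L 'h) set \<Rightarrow> ((('h \<Rightarrow>\<^sub>L 'h) \<Rightarrow> complex) \<Rightarrow> complex) matrix_norms" where
  "free_mnorm n X = dual_mnorm (Lip0 X) (Lip_mnorm n X)"

definition evaluation_span ::
  "('h::complex_hilbert \<Rightarrow>\<^sub>L 'h) set \<Rightarrow> ((('h \<Rightarrow>\<^sub>L 'h) \<Rightarrow> complex) \<Rightarrow> complex) set" where
  "evaluation_span X =
     {\<Sum>i<m. a i *\<^sub>C evaluation X (x i) | (m::nat) a x. \<forall>i<m. x i \<in> X}"

definition free_space ::
  "nat \<Rightarrow> ('h::complex_hilbert \<Rightarrow>\<^sub>L 'h) set \<Rightarrow> ((('h \<Rightarrow>\<^sub>L 'h) \<Rightarrow> complex) \<Rightarrow> complex) set" where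
  "free_space n X =
     {\<phi> \<in> dual (Lip0 X) (Lip_mnorm n X).
        \<forall>\<epsilon>>0. \<exists>\<psi>\<in>evaluation_span X. free_mnorm n X 1 (\<lambda>_ _. \<phi> - \<psi>) < ennreal \<epsilon>}"

text \<open>The barycentre map \<open>\<beta>\<close>, set to 0 outside its domain so that it is unique as a total function.\<close>

definition beta ::
  "nat \<Rightarrow> ('h::complex_hilbert \<Rightarrow>\<^sub>L 'h) set \<Rightarrow> ((('h \<Rightarrow>\<^sub>L 'h) \<Rightarrow> complex) \<Rightarrow> complex) \<Rightarrow> ('h \<Rightarrow>\<^sub>L 'h)" where
  "beta n X = (THE \<beta>.
     \<beta> ` free_space n X \<subseteq> X \<and>
     (\<forall>\<phi>. \<phi> \<notin> free_space n X \<longrightarrow> \<beta> \<phi> = 0) \<and>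
     clinear_on (free_space n X) \<beta> \<and>
     (\<exists>C. \<forall>\<phi>\<in>free_space n X. ennreal (norm (\<beta> \<phi>)) \<le> ennreal C * free_mnorm n X 1 (\<lambda>_ _. \<phi>)) \<and>
     (\<forall>(m::nat) a x. (\<forall>i<m. x i \<in> X) \<longrightarrow>
        \<beta> (\<Sum>i<m. a i *\<^sub>C evaluation X (x i)) = (\<Sum>i<m. a i *\<^sub>C x i)))"

definition isometric_Lipschitz_lifting :: "nat \<Rightarrow> ('h::complex_hilbert \<Rightarrow>\<^sub>L 'h) set \<Rightarrow> bool" where
  "isometric_Lipschitz_lifting n X \<longleftrightarrow>
     (\<exists>T. T ` X \<subseteq> free_space n X \<and> n_contraction X op_mnorm (free_mnorm n X) n T \<and>
          (\<forall>x\<in>X. beta n X (T x) = x))"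

end

theory Submission
  imports Defs
begin

text \<open>
The lifting is an averaged derivative. Fix vectors \<open>x\<^sub>k \<in> X\<close> with \<open>\<Sum>\<^sub>k \<parallel>x\<^sub>k\<parallel> < \<infinity>\<close> such that
the multiples \<open>m x\<^sub>k\<close> with \<open>m \<in> \<nat>\<close> are dense in \<open>X\<close>, and let \<open>\<mu>\<close> be the distribution of
\<open>\<Sum>\<^sub>k t\<^sub>k x\<^sub>k\<close> for independent \<open>t\<^sub>k\<close>, uniform in \<open>[0, 1]\<close>. Consider the functionals
\<open>D\<^sub>s y (f) = \<integral> (f (z + s y) - f z) / s d\<mu>(z)\<close>. For every \<open>s > 0\<close> the barycentre of \<open>D\<^sub>s y\<close> is \<open>y\<close>,
and \<open>y \<mapsto> D\<^sub>s y\<close> contracts matrices of order \<open>n\<close>, because the \<open>n\<close>-th amplification of \<open>f\<close> is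
compared at two matrices that differ by \<open>s [y\<^sub>i\<^sub>j]\<close>. Only linearity in \<open>y\<close> is missing, and it
appears in the limit \<open>s \<rightarrow> 0\<close>.

To see that the limit exists in norm, take \<open>y = x\<^sub>k\<close>. Integrating the difference quotient over
\<open>t\<^sub>k\<close> telescopes and leaves \<open>\<integral> f (w + x\<^sub>k) - f w\<close>, up to \<open>O(s)\<close>, where \<open>w\<close> runs over the sums
without the \<open>k\<close>-th coordinate. This depends continuously on the base point, so a translation of
\<open>z\<close> by \<open>O(s)\<close> does not affect the limit. Since \<open>D\<^sub>s (y + y')\<close> is the sum of \<open>D\<^sub>s y\<close> and of a copy of
\<open>D\<^sub>s y'\<close> based at a point translated by \<open>s y\<close>, convergence passes to sums, and the limit is
additive. As \<open>D\<^sub>s\<close> is 1-Lipschitz in \<open>y\<close>, convergence passes from the multiples \<open>m x\<^sub>k\<close> to all of \<open>X\<close>.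

Everything can be done with finite averages. Let \<open>s = 2\<^sup>-\<^sup>N\<close> and replace \<open>t\<^sub>k\<close> by
\<open>\<Sum>\<^sub>l \<epsilon>\<^sub>k\<^sub>l 2\<^sup>-\<^sup>l\<close> with independent bits \<open>\<epsilon>\<^sub>k\<^sub>l\<close>, where \<open>k < N\<close> and \<open>1 \<le> l \<le> N\<close>. Then \<open>\<mu>\<close> becomes the uniform
distribution on the vertices of a cube whose edges are the vectors \<open>2\<^sup>-\<^sup>l x\<^sub>k\<close>; the difference
quotients are combinations of evaluations, and the telescoping is an exact identity
(\<open>cube_avg_dyadic_telescope\<close>). The convergence is the content of \<open>stable_all\<close>, and
\<open>lift_add\<close>, \<open>lift_scaleR\<close> give a real-linear lifting \<open>S\<close>. A complex-linear one with the same bounds is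
\<open>T y = (S y - \<i> S (\<i> y)) / 2\<close>; it is an \<open>n\<close>-contraction by \<open>complex_lift_n_contraction\<close>.

The estimates for single functions bound the norm in the free space, because a matrix of functions
with \<open>Lip\<^sub>n \<le> 1\<close> becomes a scalar Lipschitz function when it is compressed by two vectors
(\<open>n_lipschitz_compress\<close>, \<open>free_mnorm_le\<close>). This puts \<open>T y\<close> into the closed span of the evaluations.

The map \<open>\<beta>\<close> is handled through the coefficient functions \<open>A \<mapsto> \<langle>A h, k\<rangle>\<close> with \<open>\<parallel>h\<parallel>, \<parallel>k\<parallel> \<le> 1\<close>. They are
linear with \<open>Lip\<^sub>n \<le> 1\<close> and compute the norm of \<open>A\<close>, so they do the work of the Hahn-Banach theorem:
\<open>\<beta> \<phi>\<close> is the only \<open>y\<close> with \<open>\<langle>y h, k\<rangle> = \<phi> (A \<mapsto> \<langle>A h, k\<rangle>)\<close> for all such \<open>h\<close> and \<open>k\<close> (\<open>barycentre_beta\<close>). Since an averaged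
difference quotient in direction \<open>y\<close> of a linear function is its value at \<open>y\<close>, this gives \<open>\<beta> (T y) = y\<close>.
\<close>

section \<open>Averages over the vertices of a cube\<close>

text \<open>The subsets of \<open>I\<close> are the vertices of the cube based at \<open>z\<close> with edge vectors \<open>v i\<close>.\<close>

definition cube_avg :: "('i \<Rightarrow> 'b::real_vector) \<Rightarrow> 'i set \<Rightarrow> ('b \<Rightarrow> complex) \<Rightarrow> 'b \<Rightarrow> complex" where
  "cube_avg v I f z = (\<Sum>S\<in>Pow I. f (z + sum v S)) / 2 ^ card I"

lemma cube_avg_empty [simp]: "cube_avg v {} f z = f z"
  by (simp add: cube_avg_def)

text \<open>Averaging over one more edge is a separate operation, a mean of two translates. All
  inductions over the edges rest on this.\<close>

lemma cube_avg_insert: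
  assumes "finite I" "i \<notin> I"
  shows "cube_avg v (insert i I) f z = (cube_avg v I f z + cube_avg v I f (z + v i)) / 2"
proof -
  have inj: "inj_on (insert i) (Pow I)"
    using assms(2) by (auto simp: inj_on_def)
  have disj: "Pow I \<inter> insert i ` Pow I = {}"
    using assms(2) by auto
  have "(\<Sum>S\<in>insert i ` Pow I. f (z + sum v S)) = (\<Sum>S\<in>Pow I. f (z + v i + sum v S))"
    unfolding sum.reindex [OF inj] comp_def
  proof (rule sum.cong [OF refl])
    fix S assume "S \<in> Pow I"
    then have "finite S" "i \<notin> S"
      using assms finite_subset by auto
    then show "f (z + sum v (insert i S)) = f (z + v i + sum v S)"
      by (simp add: add.assoc)
  qed
  moreover have "(\<Sum>S\<in>Pow (insert i I). f (z + sum v S)) =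
      (\<Sum>S\<in>Pow I. f (z + sum v S)) + (\<Sum>S\<in>insert i ` Pow I. f (z + sum v S))"
    unfolding Pow_insert by (rule sum.union_disjoint) (use assms disj in auto)
  ultimately show ?thesis
    using assms by (simp add: cube_avg_def field_simps)
qed

lemma cube_avg_add: "cube_avg v I (\<lambda>z. f z + g z) z = cube_avg v I f z + cube_avg v I g z"
  by (simp add: cube_avg_def sum.distrib add_divide_distrib)

lemma cube_avg_cmult: "cube_avg v I (\<lambda>z. c * f z) z = c * cube_avg v I f z"
  by (simp add: cube_avg_def sum_distrib_left)

lemma cube_avg_lipschitz:
  fixes X :: "'b::real_normed_vector set"
  assumes "finite I" "subspace X" "\<And>i. i \<in> I \<Longrightarrow> v i \<in> X" "L-lipschitz_on X f"
  shows "L-lipschitz_on X (cube_avg v I f)"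
  using assms(1,3)
proof (induction I)
  case empty
  have "cube_avg v {} f = f"
    by (rule ext) simp
  then show ?case
    using assms(4) by simp
next
  case (insert i I)
  then have IH: "L-lipschitz_on X (cube_avg v I f)" and vi: "v i \<in> X"
    by auto
  show ?case
  proof (rule lipschitz_onI)
    fix z w assume "z \<in> X" "w \<in> X"
    then have "z + v i \<in> X" "w + v i \<in> X"
      using assms(2) vi subspace_add by blast+
    then have "norm (cube_avg v I f (z + v i) - cube_avg v I f (w + v i)) \<le> L * norm (z - w)"
      "norm (cube_avg v I f z - cube_avg v I f w) \<le> L * norm (z - w)"
      using lipschitz_on_normD [OF IH, of "z + v i" "w + v i"]
        lipschitz_on_normD [OF IH] \<open>z \<in> X\<close> \<open>w \<in> X\<close> by auto
    then have "norm ((cube_avg v I f z - cube_avg v I f w) +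
        (cube_avg v I f (z + v i) - cube_avg v I f (w + v i))) \<le> 2 * (L * norm (z - w))"
      using norm_triangle_ineq order_trans
      by (smt (verit))
    moreover have half: "cube_avg v (insert i I) f z - cube_avg v (insert i I) f w =
        ((cube_avg v I f z - cube_avg v I f w) +
        (cube_avg v I f (z + v i) - cube_avg v I f (w + v i))) / 2"
      using insert by (simp add: cube_avg_insert field_simps)
    ultimately show "dist (cube_avg v (insert i I) f z) (cube_avg v (insert i I) f w) \<le> L * dist z w"
      unfolding dist_norm half norm_divide by simp
  qed (use assms(4) lipschitz_on_nonneg in blast)
qed

text \<open>Each additional edge moves the points of half of the average by the edge vector, and the
  average is Lipschitz with the same constant as \<open>f\<close>.\<close>

lemma cube_avg_mono_index:
  fixes X :: "'b::real_normed_vector set"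
  assumes "finite J" "I \<subseteq> J" "subspace X" "\<And>i. i \<in> J \<Longrightarrow> v i \<in> X" "L-lipschitz_on X f" "z \<in> X"
  shows "norm (cube_avg v J f z - cube_avg v I f z) \<le> L * (\<Sum>i\<in>J - I. norm (v i))"
proof -
  have "norm (cube_avg v (K \<union> I) f z - cube_avg v I f z) \<le> L * (\<Sum>i\<in>K. norm (v i))"
    if "finite K" "K \<subseteq> J - I" for K
    using that
  proof (induction K)
    case (insert k K)
    let ?F = "cube_avg v (K \<union> I) f"
    have fin: "finite (K \<union> I)" and "k \<notin> K \<union> I"
      using insert assms(1,2) finite_subset by auto
    then have half: "cube_avg v (insert k K \<union> I) f z - ?F z = (?F (z + v k) - ?F z) / 2"
      by (simp add: cube_avg_insert field_simps)
    have "L-lipschitz_on X ?F"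
      by (rule cube_avg_lipschitz) (use fin insert assms in auto)
    then have "norm (?F (z + v k) - ?F z) \<le> L * norm (v k)"
      using lipschitz_on_normD [of L X ?F "z + v k" z] assms insert subspace_add by fastforce
    then have "norm (cube_avg v (insert k K \<union> I) f z - ?F z) \<le> L * norm (v k) / 2"
      unfolding half by (simp add: norm_divide)
    also have "\<dots> \<le> L * norm (v k)"
      using lipschitz_on_nonneg [OF assms(5)] by simp
    finally have "norm (cube_avg v (insert k K \<union> I) f z - ?F z) \<le> L * norm (v k)" .
    moreover have "norm (?F z - cube_avg v I f z) \<le> L * (\<Sum>i\<in>K. norm (v i))"
      using insert by auto
    ultimately have "norm ((cube_avg v (insert k K \<union> I) f z - ?F z) + (?F z - cube_avg v I f z))
        \<le> L * norm (v k) + L * (\<Sum>i\<in>K. norm (v i))"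
      using norm_triangle_mono by blast
    then show ?case
      using insert by (simp add: distrib_left)
  qed simp
  from this [of "J - I"] show ?thesis
    using assms(1,2) by (simp add: Un_absorb2)
qed

lemma cube_avg_diff_const:
  assumes "finite I" "subspace X" "\<And>i. i \<in> I \<Longrightarrow> v i \<in> X" "z \<in> X"
    and "\<And>z. z \<in> X \<Longrightarrow> f (z + w) - f z = c"
  shows "cube_avg v I f (z + w) - cube_avg v I f z = c"
  using assms(1,3,4)
proof (induction I arbitrary: z)
  case (insert i I)
  then have "cube_avg v I f (z + w) - cube_avg v I f z = c"
    "cube_avg v I f (z + v i + w) - cube_avg v I f (z + v i) = c"
    using assms(2) subspace_add by (metis insertCI)+
  then show ?case
    using insert by (simp add: cube_avg_insert algebra_simps flip: add_divide_distrib diff_divide_distrib)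
qed (use assms in auto)

text \<open>The sums of subsets of the edges \<open>x/2, \<dots>, x/2\<^sup>N\<close> are the points \<open>j x / 2\<^sup>N\<close> with \<open>0 \<le> j < 2\<^sup>N\<close>, each
  attained once. The differences of \<open>f\<close> over steps of \<open>x / 2\<^sup>N\<close> along these points telescope to one
  step of \<open>x\<close>. In the induction, the edge \<open>x/2\<^sup>N\<^sup>+\<^sup>1\<close> merges two half steps into one.\<close>

lemma cube_avg_dyadic_telescope:
  fixes v :: "nat \<times> nat \<Rightarrow> 'b::real_vector"
  assumes "finite J" "\<And>l. (k, l) \<notin> J" "\<And>l. v (k, l) = (1/2) ^ l *\<^sub>R x"
  shows "2 ^ N * (cube_avg v ({k} \<times> {1..N} \<union> J) f (z + (1/2) ^ N *\<^sub>R x)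
            - cube_avg v ({k} \<times> {1..N} \<union> J) f z)
         = cube_avg v J f (z + x) - cube_avg v J f z"
proof (induction N)
  case (Suc N)
  let ?I = "{k} \<times> {1..N} \<union> J"
  have "{k} \<times> {1..Suc N} \<union> J = insert (k, Suc N) ?I"
    by (auto simp: le_Suc_eq)
  moreover have "finite ?I" "(k, Suc N) \<notin> ?I"
    using assms by auto
  ultimately have ins: "cube_avg v ({k} \<times> {1..Suc N} \<union> J) f w =
      (cube_avg v ?I f w + cube_avg v ?I f (w + (1/2) ^ Suc N *\<^sub>R x)) / 2" for w
    using cube_avg_insert [of ?I "(k, Suc N)" v f w] assms(3) by simp
  have "z + (1/2) ^ Suc N *\<^sub>R x + (1/2) ^ Suc N *\<^sub>R x = z + (1/2) ^ N *\<^sub>R x"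
    by (simp add: add.assoc flip: scaleR_add_left)
  then have "2 ^ Suc N * (cube_avg v ({k} \<times> {1..Suc N} \<union> J) f (z + (1/2) ^ Suc N *\<^sub>R x)
            - cube_avg v ({k} \<times> {1..Suc N} \<union> J) f z) =
      2 ^ N * (cube_avg v ?I f (z + (1/2) ^ N *\<^sub>R x) - cube_avg v ?I f z)"
    unfolding ins
    by (simp only: power_Suc diff_divide_distrib [symmetric]) (simp add: field_simps)
  then show ?case
    using Suc.IH by (rule trans)
qed simp

section \<open>Averaged difference quotients and their limit\<close>

lemma scaled_below: "0 < e \<Longrightarrow> 0 \<le> L \<Longrightarrow> \<exists>\<epsilon>>0. \<epsilon> * L < (e::real)"
  by (intro exI [of _ "e / (L + 1)"]) (simp add: field_simps)

text \<open>The geometric decay makes the edges \<open>2\<^sup>-\<^sup>l x\<^sub>k\<close> summable. Density is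
  stated for natural multiples, since convergence of the difference quotients passes to sums.\<close>

locale dyadic_cube =
  fixes X :: "'b::real_normed_vector set" and x :: "nat \<Rightarrow> 'b"
  assumes subspace_X: "subspace X"
    and x_in: "x k \<in> X"
    and norm_x: "norm (x k) \<le> (1/2) ^ k"
    and multiples_dense: "y \<in> X \<Longrightarrow> 0 < \<epsilon> \<Longrightarrow> \<exists>k m. norm (y - real m *\<^sub>R x k) < \<epsilon>"
begin

definition edge :: "nat \<times> nat \<Rightarrow> 'b" where
  "edge = (\<lambda>(k, l). (1/2) ^ l *\<^sub>R x k)"

text \<open>The level \<open>l = 0\<close> is absent: the coordinate of a vertex along \<open>x\<^sub>k\<close> takes the values
  \<open>j / 2\<^sup>N\<close> with \<open>0 \<le> j < 2\<^sup>N\<close>, so that a step of \<open>x\<^sub>k / 2\<^sup>N\<close> leads to the next one.\<close>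

definition edges :: "nat \<Rightarrow> (nat \<times> nat) set" where
  "edges N = {..<N} \<times> {1..N}"

abbreviation avg :: "nat \<Rightarrow> ('b \<Rightarrow> complex) \<Rightarrow> 'b \<Rightarrow> complex" where
  "avg N \<equiv> cube_avg edge (edges N)"

text \<open>The base point \<open>z\<close> is a parameter since splitting a sum of directions translates it.\<close>

definition quotient :: "nat \<Rightarrow> 'b \<Rightarrow> 'b \<Rightarrow> ('b \<Rightarrow> complex) \<Rightarrow> complex" where
  "quotient N z y f = 2 ^ N * (avg N f (z + (1/2) ^ N *\<^sub>R y) - avg N f z)"

lemma edge_in: "edge i \<in> X"
  by (auto simp: edge_def split: prod.split intro: subspace_scale [OF subspace_X] x_in)

lemma finite_edges [simp]: "finite (edges N)"
  by (simp add: edges_def)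

lemma edges_mono: "N \<le> M \<Longrightarrow> edges N \<subseteq> edges M"
  by (auto simp: edges_def)

lemma zero_in: "0 \<in> X" and add_in: "a \<in> X \<Longrightarrow> b \<in> X \<Longrightarrow> a + b \<in> X"
  and scale_in: "a \<in> X \<Longrightarrow> r *\<^sub>R a \<in> X"
  using subspace_X by (auto simp: subspace_def)

lemma avg_lipschitz: "L-lipschitz_on X f \<Longrightarrow> L-lipschitz_on X (avg N f)"
  by (rule cube_avg_lipschitz) (auto simp: subspace_X edge_in)

text \<open>At a fixed stage \<open>N\<close> the quotient is already contractive in the direction; it is not yet
  additive there.\<close>

lemma quotient_lipschitz:
  assumes "L-lipschitz_on X f" "z \<in> X" "y \<in> X" "y' \<in> X"
  shows "norm (quotient N z y f - quotient N z y' f) \<le> L * norm (y - y')"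
proof -
  let ?p = "z + (1/2) ^ N *\<^sub>R y" and ?q = "z + (1/2) ^ N *\<^sub>R y'"
  have "norm (avg N f ?p - avg N f ?q) \<le> L * norm (?p - ?q)"
    by (rule lipschitz_on_normD [OF avg_lipschitz]) (use assms in \<open>auto intro: add_in scale_in\<close>)
  also have "norm (?p - ?q) = (1/2) ^ N * norm (y - y')"
    by (simp flip: scaleR_diff_right)
  finally have "2 ^ N * norm (avg N f ?p - avg N f ?q) \<le> 2 ^ N * (L * ((1/2) ^ N * norm (y - y')))"
    by (rule mult_left_mono) simp
  then have "norm (2 ^ N * (avg N f ?p - avg N f ?q)) \<le> L * norm (y - y')"
    by (simp add: norm_mult norm_power power_divide)
  moreover have "quotient N z y f - quotient N z y' f = 2 ^ N * (avg N f ?p - avg N f ?q)"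
    by (simp add: quotient_def algebra_simps)
  ultimately show ?thesis
    by simp
qed

lemma quotient_zero [simp]: "quotient N z 0 f = 0"
  by (simp add: quotient_def)

lemma norm_quotient_le:
  assumes "L-lipschitz_on X f" "z \<in> X" "y \<in> X"
  shows "norm (quotient N z y f) \<le> L * norm y"
  using quotient_lipschitz [OF assms zero_in] by simp

lemma quotient_add:
  "quotient N z (y + y') f = quotient N z y f + quotient N (z + (1/2) ^ N *\<^sub>R y) y' f"
  by (simp add: quotient_def algebra_simps)

lemma quotient_linear:
  "quotient N z y (\<lambda>w. f w + g w) = quotient N z y f + quotient N z y g"
  "quotient N z y (\<lambda>w. c * f w) = c * quotient N z y f"
  by (simp_all add: quotient_def cube_avg_add cube_avg_cmult algebra_simps)

definition other_edges :: "nat \<Rightarrow> nat \<Rightarrow> (nat \<times> nat) set" where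
  "other_edges k N = ({..<N} - {k}) \<times> {1..N}"

text \<open>In direction \<open>x k\<close> the factor \<open>2 ^ N\<close> disappears, which is why the quotients converge.\<close>

lemma quotient_generator:
  assumes "k < N"
  shows "quotient N z (x k) f =
    cube_avg edge (other_edges k N) f (z + x k) - cube_avg edge (other_edges k N) f z"
proof -
  have "edges N = {k} \<times> {1..N} \<union> other_edges k N"
    using assms by (auto simp: edges_def other_edges_def)
  then show ?thesis
    unfolding quotient_def
    using cube_avg_dyadic_telescope [of "other_edges k N" k edge "x k" N f z]
    by (simp add: other_edges_def edge_def)
qed

definition total_length :: "nat \<Rightarrow> real" where
  "total_length N = (\<Sum>i\<in>edges N. norm (edge i))"

text \<open>The total length of the edges is bounded by \<open>\<Sum>\<^sub>k \<Sum>\<^sub>l 2\<^sup>-\<^sup>k 2\<^sup>-\<^sup>l\<close>, so refining the cube at a late stage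
  changes averages of Lipschitz functions very little.\<close>

lemma total_length_Cauchy: "Cauchy total_length"
proof -
  have "total_length N \<le> total_length M" if "N \<le> M" for N M
    unfolding total_length_def by (rule sum_mono2) (use edges_mono that in auto)
  then have "incseq total_length"
    by (simp add: incseq_def)
  moreover have "total_length N \<le> 2" for N
  proof -
    have "total_length N = (\<Sum>k<N. \<Sum>l\<in>{1..N}. norm (edge (k, l)))"
      unfolding total_length_def edges_def by (simp add: sum.cartesian_product)
    also have "\<dots> \<le> (\<Sum>k<N. \<Sum>l\<in>{1..N}. (1/2) ^ l * (1/2) ^ k)"
      by (intro sum_mono) (use norm_x in \<open>simp add: edge_def power_divide divide_simps\<close>)
    also have "\<dots> = (\<Sum>k<N. (1/2::real) ^ k) * (\<Sum>l\<in>{1..N}. (1/2) ^ l)"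
      by (simp add: sum_product mult.commute)
    also have "\<dots> \<le> 2 * 1"
    proof (rule mult_mono)
      show "(\<Sum>k<N. (1/2::real) ^ k) \<le> 2"
        by (simp add: sum_gp_strict)
      show "(\<Sum>l\<in>{1..N}. (1/2::real) ^ l) \<le> 1"
        by (simp add: sum_gp)
    qed (auto intro: sum_nonneg)
    finally show ?thesis
      by simp
  qed
  ultimately obtain l where "total_length \<longlonglongrightarrow> l"
    using incseq_convergent [of total_length 2] by blast
  then show ?thesis
    by (rule LIMSEQ_imp_Cauchy)
qed

text \<open>Convergence of the quotients in direction \<open>y\<close>, uniformly over functions with a common Lipschitz
  constant and over base points near 0. The freedom in the base points is what makes the
  property pass to sums, and the uniformity in \<open>f\<close> is convergence in norm of functionals.\<close>

definition stable :: "'b \<Rightarrow> bool" where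
  "stable y \<longleftrightarrow> (\<forall>\<epsilon>>0. \<exists>\<delta>>0. \<exists>N0. \<forall>N\<ge>N0. \<forall>M\<ge>N0. \<forall>z\<in>X. \<forall>w\<in>X. \<forall>f L.
      norm z \<le> \<delta> \<longrightarrow> norm w \<le> \<delta> \<longrightarrow> L-lipschitz_on X f \<longrightarrow>
      norm (quotient N z y f - quotient M w y f) \<le> \<epsilon> * L)"

lemma other_edges_le:
  assumes "k < N" "N \<le> M" "L-lipschitz_on X f" "z \<in> X"
  shows "norm (cube_avg edge (other_edges k M) f z - cube_avg edge (other_edges k N) f z)
    \<le> L * (total_length M - total_length N)"
proof -
  have "norm (cube_avg edge (other_edges k M) f z - cube_avg edge (other_edges k N) f z)
      \<le> L * (\<Sum>i\<in>other_edges k M - other_edges k N. norm (edge i))"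
    by (rule cube_avg_mono_index [where X = X])
      (use assms in \<open>auto simp: other_edges_def edge_in subspace_X\<close>)
  also have "\<dots> \<le> L * (\<Sum>i\<in>edges M - edges N. norm (edge i))"
    by (intro mult_left_mono sum_mono2 lipschitz_on_nonneg [OF assms(3)])
      (use assms in \<open>auto simp: other_edges_def edges_def\<close>)
  also have "(\<Sum>i\<in>edges M - edges N. norm (edge i)) = total_length M - total_length N"
    unfolding total_length_def by (rule sum_diff) (use assms edges_mono in auto)
  finally show ?thesis .
qed

lemma stable_generator: "stable (x k)"
  unfolding stable_def
proof (intro allI impI)
  fix \<epsilon> :: real assume "\<epsilon> > 0"
  then obtain N0 where "\<And>M N. M \<ge> N0 \<Longrightarrow> N \<ge> N0 \<Longrightarrow> norm (total_length M - total_length N) < \<epsilon> / 4"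
    using CauchyD [OF total_length_Cauchy, of "\<epsilon> / 4"] by auto
  then have N0: "\<And>M N. M \<ge> N0 \<Longrightarrow> N \<ge> N0 \<Longrightarrow> total_length M - total_length N \<le> \<epsilon> / 4"
    by (metis abs_ge_self less_imp_le order_trans real_norm_def)
  define N1 where "N1 = max N0 (Suc k)"
  have close: "norm (quotient N z (x k) f - quotient M w (x k) f) \<le> \<epsilon> * L"
    if NM: "N \<ge> N1" "M \<ge> N1" and zw: "z \<in> X" "w \<in> X" "norm z \<le> \<epsilon> / 8" "norm w \<le> \<epsilon> / 8"
      and f: "L-lipschitz_on X f" for N M z w f L
  proof -
    have L0: "L \<ge> 0"
      using f lipschitz_on_nonneg by blast
    (* Four errors of L * \<epsilon> / 4: at the two ends of the step x k, once for the change of the stage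
       and once for the change of the base point. *)
    let ?A = "\<lambda>N. cube_avg edge (other_edges k N) f"
    have 1: "norm (?A N u - ?A M u) \<le> L * (\<epsilon> / 4)" if "u \<in> X" for u
    proof (cases "N \<le> M")
      case True
      then have "norm (?A M u - ?A N u) \<le> L * (total_length M - total_length N)"
        by (intro other_edges_le) (use NM f that in \<open>auto simp: N1_def\<close>)
      also have "\<dots> \<le> L * (\<epsilon> / 4)"
        using N0 [of M N] NM L0 by (intro mult_left_mono) (auto simp: N1_def)
      finally show ?thesis
        by (simp add: norm_minus_commute)
    next
      case False
      then have "norm (?A N u - ?A M u) \<le> L * (total_length N - total_length M)"
        by (intro other_edges_le) (use NM f that in \<open>auto simp: N1_def\<close>)
      also have "\<dots> \<le> L * (\<epsilon> / 4)"
        using N0 [of N M] NM L0 by (intro mult_left_mono) (auto simp: N1_def)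
      finally show ?thesis .
    qed
    have lip: "L-lipschitz_on X (?A M)"
      by (rule cube_avg_lipschitz) (auto simp: other_edges_def edge_in subspace_X f)
    have "norm (z - w) \<le> \<epsilon> / 4"
      using zw norm_triangle_ineq4 [of z w] by linarith
    then have zw': "L * norm (z - w) \<le> L * (\<epsilon> / 4)"
      using L0 by (rule mult_left_mono)
    have 2: "norm (?A M u - ?A M u') \<le> L * (\<epsilon> / 4)" if "u \<in> X" "u' \<in> X" "u - u' = z - w" for u u'
      using lipschitz_on_normD [OF lip that(1,2)] zw' that(3) by simp
    have "quotient N z (x k) f - quotient M w (x k) f =
        ((?A N (z + x k) - ?A M (z + x k)) + (?A M (z + x k) - ?A M (w + x k)))
        - ((?A N z - ?A M z) + (?A M z - ?A M w))"
      using NM by (simp add: quotient_generator N1_def)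
    also have "norm \<dots> \<le> (L * (\<epsilon> / 4) + L * (\<epsilon> / 4)) + (L * (\<epsilon> / 4) + L * (\<epsilon> / 4))"
      by (intro order_trans [OF norm_triangle_ineq4] add_mono order_trans [OF norm_triangle_ineq] 1 2)
        (use zw in \<open>auto intro: add_in x_in\<close>)
    finally show ?thesis
      by (simp add: mult.commute)
  qed
  then show "\<exists>\<delta>>0. \<exists>N0. \<forall>N\<ge>N0. \<forall>M\<ge>N0. \<forall>z\<in>X. \<forall>w\<in>X. \<forall>f L.
      norm z \<le> \<delta> \<longrightarrow> norm w \<le> \<delta> \<longrightarrow> L-lipschitz_on X f \<longrightarrow>
      norm (quotient N z (x k) f - quotient M w (x k) f) \<le> \<epsilon> * L"
    using \<open>\<epsilon> > 0\<close> by (intro exI [of _ "\<epsilon> / 8"] conjI exI [of _ N1]) auto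
qed

text \<open>The quotient in direction \<open>y + y'\<close> is the one in direction \<open>y\<close> plus one in direction \<open>y'\<close> based at
  \<open>z + y/2\<^sup>N\<close>, and for large \<open>N\<close> this base point is still near 0.\<close>

lemma stable_add:
  assumes "stable y" "stable y'" "y \<in> X"
  shows "stable (y + y')"
  unfolding stable_def
proof (intro allI impI)
  fix \<epsilon> :: real assume "\<epsilon> > 0"
  then have "\<epsilon> / 2 > 0" by simp
  obtain d1 N1 where d1: "d1 > 0" and
    1: "\<And>N M z w f L. N \<ge> N1 \<Longrightarrow> M \<ge> N1 \<Longrightarrow> z \<in> X \<Longrightarrow> w \<in> X \<Longrightarrow> norm z \<le> d1 \<Longrightarrow> norm w \<le> d1 \<Longrightarrow>
      L-lipschitz_on X f \<Longrightarrow> norm (quotient N z y f - quotient M w y f) \<le> \<epsilon> / 2 * L"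
    using assms(1) \<open>\<epsilon> / 2 > 0\<close> unfolding stable_def by meson
  obtain d2 N2 where d2: "d2 > 0" and
    2: "\<And>N M z w f L. N \<ge> N2 \<Longrightarrow> M \<ge> N2 \<Longrightarrow> z \<in> X \<Longrightarrow> w \<in> X \<Longrightarrow> norm z \<le> d2 \<Longrightarrow> norm w \<le> d2 \<Longrightarrow>
      L-lipschitz_on X f \<Longrightarrow> norm (quotient N z y' f - quotient M w y' f) \<le> \<epsilon> / 2 * L"
    using assms(2) \<open>\<epsilon> / 2 > 0\<close> unfolding stable_def by meson
  have "(\<lambda>N. norm ((1/2::real) ^ N *\<^sub>R y)) \<longlonglongrightarrow> norm ((0::real) *\<^sub>R y)"
    by (intro tendsto_intros LIMSEQ_realpow_zero) auto
  then have "\<forall>\<^sub>F N in sequentially. norm ((1/2::real) ^ N *\<^sub>R y) < d2 / 2"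
    using d2 by (intro order_tendstoD) auto
  then obtain N3 where N3: "\<And>N. N \<ge> N3 \<Longrightarrow> norm ((1/2::real) ^ N *\<^sub>R y) < d2 / 2"
    unfolding eventually_sequentially by blast
  define d where "d = min d1 (d2 / 2)"
  define K where "K = max N1 (max N2 N3)"
  have close: "norm (quotient N z (y + y') f - quotient M w (y + y') f) \<le> \<epsilon> * L"
    if NM: "N \<ge> K" "M \<ge> K" and zw: "z \<in> X" "w \<in> X" "norm z \<le> d" "norm w \<le> d"
      and f: "L-lipschitz_on X f" for N M z w f L
  proof -
    let ?z = "z + (1/2) ^ N *\<^sub>R y" and ?w = "w + (1/2) ^ M *\<^sub>R y"
    have small: "norm ?z \<le> d2" "norm ?w \<le> d2"
      using norm_triangle_ineq [of z "(1/2) ^ N *\<^sub>R y"] norm_triangle_ineq [of w "(1/2) ^ M *\<^sub>R y"]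
        N3 [of N] N3 [of M] NM zw unfolding d_def K_def by linarith+
    have "?z \<in> X" "?w \<in> X"
      using zw assms(3) add_in scale_in by blast+
    then have "norm (quotient N ?z y' f - quotient M ?w y' f) \<le> \<epsilon> / 2 * L"
      using small NM f by (intro 2) (auto simp: K_def)
    moreover have "norm (quotient N z y f - quotient M w y f) \<le> \<epsilon> / 2 * L"
      using NM f zw by (intro 1) (auto simp: K_def d_def)
    ultimately have "norm ((quotient N z y f - quotient M w y f) + (quotient N ?z y' f - quotient M ?w y' f))
        \<le> \<epsilon> / 2 * L + \<epsilon> / 2 * L"
      using norm_triangle_mono by blast
    then show ?thesis
      by (simp add: quotient_add algebra_simps)
  qed
  show "\<exists>\<delta>>0. \<exists>N0. \<forall>N\<ge>N0. \<forall>M\<ge>N0. \<forall>z\<in>X. \<forall>w\<in>X. \<forall>f L.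
      norm z \<le> \<delta> \<longrightarrow> norm w \<le> \<delta> \<longrightarrow> L-lipschitz_on X f \<longrightarrow>
      norm (quotient N z (y + y') f - quotient M w (y + y') f) \<le> \<epsilon> * L"
    using d1 d2 close by (intro exI [of _ d] conjI exI [of _ K]) (auto simp: d_def)
qed

lemma stable_multiple: "stable (real m *\<^sub>R x k)"
proof (induction m)
  case 0
  show ?case
    unfolding stable_def by (auto intro!: exI [of _ 1] mult_nonneg_nonneg dest: lipschitz_on_nonneg)
next
  case (Suc m)
  then have "stable (x k + real m *\<^sub>R x k)"
    by (intro stable_add stable_generator x_in)
  then show ?case
    by (simp add: scaleR_add_left)
qed

text \<open>Directions near \<open>y\<close> have nearby quotients at every stage, so the dense set of multiples
  suffices.\<close>

lemma stable_all:
  assumes "y \<in> X"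
  shows "stable y"
  unfolding stable_def
proof (intro allI impI)
  fix \<epsilon> :: real assume e: "\<epsilon> > 0"
  then obtain k m where km: "norm (y - real m *\<^sub>R x k) < \<epsilon> / 3"
    using multiples_dense [OF assms, of "\<epsilon> / 3"] by auto
  let ?y = "real m *\<^sub>R x k"
  obtain d N0 where d: "d > 0" and
    *: "\<And>N M z w f L. N \<ge> N0 \<Longrightarrow> M \<ge> N0 \<Longrightarrow> z \<in> X \<Longrightarrow> w \<in> X \<Longrightarrow> norm z \<le> d \<Longrightarrow> norm w \<le> d \<Longrightarrow>
      L-lipschitz_on X f \<Longrightarrow> norm (quotient N z ?y f - quotient M w ?y f) \<le> \<epsilon> / 3 * L"
    using stable_multiple [of m k] e unfolding stable_def
    by (metis divide_pos_pos zero_less_numeral)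
  have close: "norm (quotient N z y f - quotient M w y f) \<le> \<epsilon> * L"
    if NM: "N \<ge> N0" "M \<ge> N0" and zw: "z \<in> X" "w \<in> X" "norm z \<le> d" "norm w \<le> d"
      and f: "L-lipschitz_on X f" for N M z w f L
  proof -
    have "L * norm (y - ?y) \<le> L * (\<epsilon> / 3)"
      using km lipschitz_on_nonneg [OF f] by (intro mult_left_mono) auto
    then have near: "norm (quotient N' u y f - quotient N' u ?y f) \<le> L * (\<epsilon> / 3)" if "u \<in> X" for N' u
      using quotient_lipschitz [OF f that assms, of ?y N'] x_in scale_in order_trans by blast
    have "quotient N z y f - quotient M w y f = (quotient N z y f - quotient N z ?y f)
        + ((quotient N z ?y f - quotient M w ?y f) - (quotient M w y f - quotient M w ?y f))"
      by simp
    also have "norm \<dots> \<le> L * (\<epsilon> / 3) + (\<epsilon> / 3 * L + L * (\<epsilon> / 3))"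
      by (intro order_trans [OF norm_triangle_ineq4] order_trans [OF norm_triangle_ineq] add_mono
          near * NM zw f)
    finally show ?thesis
      by (simp add: algebra_simps)
  qed
  show "\<exists>\<delta>>0. \<exists>N0. \<forall>N\<ge>N0. \<forall>M\<ge>N0. \<forall>z\<in>X. \<forall>w\<in>X. \<forall>f L.
      norm z \<le> \<delta> \<longrightarrow> norm w \<le> \<delta> \<longrightarrow> L-lipschitz_on X f \<longrightarrow>
      norm (quotient N z y f - quotient M w y f) \<le> \<epsilon> * L"
    using d close by (intro exI [of _ d] conjI exI [of _ N0]) auto
qed

definition lift :: "'b \<Rightarrow> ('b \<Rightarrow> complex) \<Rightarrow> complex" where
  "lift y f = lim (\<lambda>N. quotient N 0 y f)"

lemma quotient_tendsto_lift:
  assumes "y \<in> X" "L-lipschitz_on X f"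
  shows "(\<lambda>N. quotient N 0 y f) \<longlonglongrightarrow> lift y f"
proof -
  have "Cauchy (\<lambda>N. quotient N 0 y f)"
  proof (rule CauchyI)
    fix e :: real assume "e > 0"
    have L: "L \<ge> 0"
      using assms(2) lipschitz_on_nonneg by blast
    obtain \<epsilon> where "\<epsilon> > 0" "\<epsilon> * L < e"
      using scaled_below [OF \<open>e > 0\<close> L] by blast
    then obtain N0 where N0: "\<And>M N. N \<ge> N0 \<Longrightarrow> M \<ge> N0 \<Longrightarrow>
        norm (quotient N 0 y f - quotient M 0 y f) \<le> \<epsilon> * L"
      using stable_all [OF assms(1)] zero_in assms(2) unfolding stable_def by (metis less_imp_le norm_zero)
    with N0 \<open>\<epsilon> * L < e\<close> show "\<exists>M. \<forall>m\<ge>M. \<forall>n\<ge>M. norm (quotient m 0 y f - quotient n 0 y f) < e"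
      by (meson order_le_less_trans)
  qed
  then show ?thesis
    unfolding lift_def using Cauchy_convergent convergent_LIMSEQ_iff by blast
qed

text \<open>One stage \<open>N\<close> serves all functions. This yields approximation in the norm of the free space.\<close>

lemma quotient_approximates_lift:
  assumes "y \<in> X" "\<epsilon> > 0"
  shows "\<exists>N. \<forall>f L. L-lipschitz_on X f \<longrightarrow> norm (lift y f - quotient N 0 y f) \<le> \<epsilon> * L"
proof -
  obtain N0 where N0: "\<And>M N f L. N \<ge> N0 \<Longrightarrow> M \<ge> N0 \<Longrightarrow> L-lipschitz_on X f \<Longrightarrow>
      norm (quotient N 0 y f - quotient M 0 y f) \<le> \<epsilon> * L"
    using stable_all [OF assms(1)] zero_in assms(2) unfolding stable_def by (metis less_imp_le norm_zero)
  have "norm (lift y f - quotient N0 0 y f) \<le> \<epsilon> * L" if f: "L-lipschitz_on X f" for f L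
  proof (rule LIMSEQ_le_const2)
    show "(\<lambda>N. norm (quotient N 0 y f - quotient N0 0 y f)) \<longlonglongrightarrow> norm (lift y f - quotient N0 0 y f)"
      by (intro tendsto_intros quotient_tendsto_lift [OF assms(1) f])
    show "\<exists>N. \<forall>n\<ge>N. norm (quotient n 0 y f - quotient N0 0 y f) \<le> \<epsilon> * L"
      using N0 f by blast
  qed
  then show ?thesis
    by blast
qed

lemma norm_lift_le:
  assumes "y \<in> X" "L-lipschitz_on X f"
  shows "norm (lift y f) \<le> L * norm y"
  by (rule LIMSEQ_le_const2 [OF tendsto_norm [OF quotient_tendsto_lift [OF assms]]])
    (use norm_quotient_le [OF assms(2) zero_in assms(1)] in blast)

text \<open>The two summands of the quotient in direction \<open>y + y'\<close> have base points \<open>0\<close> and \<open>y/2\<^sup>N\<close>, and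
  stability of \<open>y'\<close> makes the second one harmless in the limit.\<close>

lemma lift_add:
  assumes "y \<in> X" "y' \<in> X" "L-lipschitz_on X f"
  shows "lift (y + y') f = lift y f + lift y' f"
proof (rule LIMSEQ_unique [OF quotient_tendsto_lift [OF add_in [OF assms(1,2)] assms(3)]])
  have "(\<lambda>N. quotient N ((1/2) ^ N *\<^sub>R y) y' f - quotient N 0 y' f) \<longlonglongrightarrow> 0"
  proof (rule LIMSEQ_I)
    fix e :: real assume "e > 0"
    have L: "L \<ge> 0"
      using assms(3) lipschitz_on_nonneg by blast
    obtain \<epsilon> where "\<epsilon> > 0" "\<epsilon> * L < e"
      using scaled_below [OF \<open>e > 0\<close> L] by blast
    then obtain d N0 where d: "d > 0" and N0: "\<And>M N z w. N \<ge> N0 \<Longrightarrow> M \<ge> N0 \<Longrightarrow> z \<in> X \<Longrightarrow> w \<in> X \<Longrightarrow>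
        norm z \<le> d \<Longrightarrow> norm w \<le> d \<Longrightarrow> norm (quotient N z y' f - quotient M w y' f) \<le> \<epsilon> * L"
      using stable_all [OF assms(2)] assms(3) unfolding stable_def by meson
    have "(\<lambda>N. norm ((1/2::real) ^ N *\<^sub>R y)) \<longlonglongrightarrow> norm ((0::real) *\<^sub>R y)"
      by (intro tendsto_intros LIMSEQ_realpow_zero) auto
    then have "\<forall>\<^sub>F N in sequentially. norm ((1/2::real) ^ N *\<^sub>R y) < d"
      using d by (intro order_tendstoD) auto
    then obtain N1 where N1: "\<And>N. N \<ge> N1 \<Longrightarrow> norm ((1/2::real) ^ N *\<^sub>R y) < d"
      unfolding eventually_sequentially by blast
    have "norm (quotient N ((1/2) ^ N *\<^sub>R y) y' f - quotient N 0 y' f) \<le> \<epsilon> * L"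
      if "N \<ge> max N0 N1" for N
      using that N1 [of N] d assms(1) zero_in by (intro N0) (auto intro: scale_in)
    with \<open>\<epsilon> * L < e\<close> show "\<exists>no. \<forall>n\<ge>no.
        norm (quotient n ((1/2) ^ n *\<^sub>R y) y' f - quotient n 0 y' f - 0) < e"
      by (metis diff_zero order_le_less_trans)
  qed
  from tendsto_add [OF tendsto_add [OF quotient_tendsto_lift [OF assms(1,3)]
        quotient_tendsto_lift [OF assms(2,3)]] this]
  show "(\<lambda>N. quotient N 0 (y + y') f) \<longlonglongrightarrow> lift y f + lift y' f"
    by (simp add: quotient_add)
qed

text \<open>An additive bounded map is real-homogeneous: multiplying the defect by \<open>m\<close> leaves only the
  fractional part \<open>t\<close> of \<open>m r\<close>, so \<open>m\<close> times the defect stays bounded.\<close>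

lemma lift_scaleR:
  assumes "y \<in> X" "L-lipschitz_on X f"
  shows "lift (r *\<^sub>R y) f = of_real r * lift y f"
proof -
  have zero: "lift 0 f = 0"
    using lift_add [OF zero_in zero_in assms(2)] by simp
  have nat: "lift (real m *\<^sub>R w) f = of_nat m * lift w f" if "w \<in> X" for m w
  proof (induction m)
    case (Suc m)
    then show ?case
      using lift_add [OF that scale_in [OF that, of "real m"] assms(2)]
      by (simp add: algebra_simps)
  qed (simp add: zero)
  have int: "lift (of_int i *\<^sub>R y) f = of_int i * lift y f" for i
  proof (cases "i \<ge> 0")
    case True
    then show ?thesis
      using nat [OF assms(1), of "nat i"] by (simp add: of_nat_nat)
  next
    case False
    have "lift (of_int i *\<^sub>R y) f + lift (real (nat (- i)) *\<^sub>R y) f = 0"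
      using lift_add [OF scale_in [OF assms(1)] scale_in [OF assms(1)] assms(2),
          of "of_int i" "real (nat (- i))"] False zero
      by (simp add: of_nat_nat)
    then show ?thesis
      using nat [OF assms(1), of "nat (- i)"] False by (simp add: of_nat_nat)
  qed
  have L: "L \<ge> 0"
    using assms(2) lipschitz_on_nonneg by blast
  define err where "err = norm (lift (r *\<^sub>R y) f - of_real r * lift y f)"
  have "real m * err \<le> 2 * L * norm y" for m
  proof -
    define t where "t = real m * r - of_int \<lfloor>real m * r\<rfloor>"
    have t: "0 \<le> t" "t \<le> 1"
      by (auto simp: t_def) linarith+
    have "of_nat m * lift (r *\<^sub>R y) f = lift ((real m * r) *\<^sub>R y) f"
      using nat [OF scale_in [OF assms(1)], of m r] by simp
    also have "(real m * r) *\<^sub>R y = of_int \<lfloor>real m * r\<rfloor> *\<^sub>R y + t *\<^sub>R y"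
      by (simp add: t_def flip: scaleR_add_left)
    also have "lift \<dots> f = of_int \<lfloor>real m * r\<rfloor> * lift y f + lift (t *\<^sub>R y) f"
      using lift_add [OF scale_in scale_in assms(2)] assms(1) int by simp
    finally have "of_nat m * (lift (r *\<^sub>R y) f - of_real r * lift y f) =
        lift (t *\<^sub>R y) f - of_real t * lift y f"
      by (simp add: t_def algebra_simps)
    then have "real m * err = norm (lift (t *\<^sub>R y) f - of_real t * lift y f)"
      unfolding err_def by (metis norm_mult norm_of_nat)
    also have "\<dots> \<le> norm (lift (t *\<^sub>R y) f) + norm (of_real t * lift y f)"
      by (rule norm_triangle_ineq4)
    also have "norm (lift (t *\<^sub>R y) f) \<le> L * norm (t *\<^sub>R y)"
      by (rule norm_lift_le [OF scale_in [OF assms(1)] assms(2)])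
    also have "\<dots> \<le> L * norm y"
      using t L by (intro mult_left_mono) (auto simp: mult_left_le_one_le)
    also have "norm (of_real t * lift y f) \<le> norm (lift y f)"
      using t by (simp add: norm_mult mult_left_le_one_le)
    also have "\<dots> \<le> L * norm y"
      by (rule norm_lift_le [OF assms])
    finally show ?thesis
      by simp
  qed
  then have "\<not> err > 0"
    by (metis reals_Archimedean3 not_le)
  then show ?thesis
    by (simp add: err_def)
qed

lemma lift_add_function:
  assumes "y \<in> X" "L-lipschitz_on X f" "L'-lipschitz_on X g"
  shows "lift y (\<lambda>w. f w + g w) = lift y f + lift y g"
  using tendsto_add [OF quotient_tendsto_lift [OF assms(1,2)] quotient_tendsto_lift [OF assms(1,3)]]
  unfolding lift_def [of y "\<lambda>w. f w + g w"] quotient_linear by (rule limI)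

lemma lift_cmult_function:
  assumes "y \<in> X" "L-lipschitz_on X f"
  shows "lift y (\<lambda>w. c * f w) = c * lift y f"
  using tendsto_mult_left [OF quotient_tendsto_lift [OF assms]]
  unfolding lift_def [of y "\<lambda>w. c * f w"] quotient_linear by (rule limI)

text \<open>Averaging does not change the increment of a linear function. This determines the barycentre
  of the lifting.\<close>

lemma quotient_of_linear:
  assumes "\<And>a b. a \<in> X \<Longrightarrow> b \<in> X \<Longrightarrow> f (a + b) = f a + f b"
    and "\<And>r a. a \<in> X \<Longrightarrow> f (r *\<^sub>R a) = of_real r * f a" and "y \<in> X"
  shows "quotient N 0 y f = f y"
proof -
  have "avg N f (0 + (1/2) ^ N *\<^sub>R y) - avg N f 0 = (1/2) ^ N * f y"
    by (rule cube_avg_diff_const [where X = X])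
      (use assms in \<open>auto simp: subspace_X edge_in zero_in scale_in\<close>)
  then show ?thesis
    unfolding quotient_def by (simp add: power_divide)
qed

lemma lift_of_linear:
  assumes "\<And>a b. a \<in> X \<Longrightarrow> b \<in> X \<Longrightarrow> f (a + b) = f a + f b"
    and "\<And>r a. a \<in> X \<Longrightarrow> f (r *\<^sub>R a) = of_real r * f a" and "y \<in> X"
  shows "lift y f = f y"
  using quotient_of_linear [OF assms] by (simp add: lift_def)

end

text \<open>Divide each term \<open>d k\<close> of a dense sequence by a power of 2 that makes it small; the multiple of
  the quotient by that power is \<open>d k\<close> again.\<close>

lemma exists_dyadic_cube:
  fixes X :: "'b::real_normed_vector set"
  assumes "subspace X" "separable_space (top_of_set X)"
  shows "\<exists>x. dyadic_cube X x"
proof -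
  obtain C where C: "countable C" "C \<subseteq> X" "top_of_set X closure_of C = X"
    using assms(2) unfolding separable_space_def by auto
  have dense: "\<exists>c\<in>C. norm (y - c) < \<epsilon>" if "y \<in> X" "0 < \<epsilon>" for y \<epsilon>
  proof -
    have "y \<in> closure C"
      using that C(2,3) closure_mono [of "X \<inter> C" C] by (auto simp: closure_of_subtopology)
    then show ?thesis
      using that(2) by (metis closure_approachable dist_commute dist_norm)
  qed
  have "C \<noteq> {}"
    using dense [of 0 1] subspace_0 [OF assms(1)] by auto
  define d where "d = from_nat_into C"
  have range: "range d = C"
    unfolding d_def by (rule range_from_nat_into [OF \<open>C \<noteq> {}\<close> C(1)])
  have "\<exists>M. norm ((1/2) ^ M *\<^sub>R d k) \<le> (1/2) ^ k" for k
  proof -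
    have "(\<lambda>M. norm ((1/2::real) ^ M *\<^sub>R d k)) \<longlonglongrightarrow> norm ((0::real) *\<^sub>R d k)"
      by (intro tendsto_intros LIMSEQ_realpow_zero) auto
    then have "\<forall>\<^sub>F M in sequentially. norm ((1/2::real) ^ M *\<^sub>R d k) < (1/2) ^ k"
      by (intro order_tendstoD) auto
    then show ?thesis
      by (meson eventually_sequentially order_refl less_imp_le)
  qed
  then obtain M where M: "\<And>k. norm ((1/2) ^ M k *\<^sub>R d k) \<le> (1/2) ^ k"
    by metis
  have "dyadic_cube X (\<lambda>k. (1/2) ^ M k *\<^sub>R d k)"
  proof
    show "subspace X"
      by (rule assms(1))
    show "(1/2) ^ M k *\<^sub>R d k \<in> X" for k
      using range C(2) by (intro subspace_scale [OF assms(1)]) auto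
    show "norm ((1/2) ^ M k *\<^sub>R d k) \<le> (1/2) ^ k" for k
      by (rule M)
    fix y and \<epsilon> :: real assume "y \<in> X" "0 < \<epsilon>"
    then obtain k where "norm (y - d k) < \<epsilon>"
      using dense range by (metis rangeE)
    moreover have "real (2 ^ M k) *\<^sub>R (1/2) ^ M k *\<^sub>R d k = d k"
      by (simp add: power_divide)
    ultimately show "\<exists>k m. norm (y - real m *\<^sub>R (1/2) ^ M k *\<^sub>R d k) < \<epsilon>"
      by metis
  qed
  then show ?thesis
    by blast
qed

section \<open>Norms of matrices of operators and of scalars\<close>

text \<open>The homogeneous form of the inequality \<open>mat_norm I A \<le> C\<close>. Unlike the supremum in \<open>mat_norm\<close> it
  is manipulated vector by vector.\<close>

definition matrix_bound :: "'i set \<Rightarrow> ('i \<Rightarrow> 'i \<Rightarrow> 'h::real_normed_vector \<Rightarrow> 'h) \<Rightarrow> real \<Rightarrow> bool" where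
  "matrix_bound I A C \<longleftrightarrow>
     (\<forall>\<xi>. L2_set (\<lambda>i. norm (\<Sum>j\<in>I. A i j (\<xi> j))) I \<le> C * L2_set (\<lambda>i. norm (\<xi> i)) I)"

lemma matrix_bound_mono: "matrix_bound I A C \<Longrightarrow> C \<le> D \<Longrightarrow> matrix_bound I A D"
  unfolding matrix_bound_def
  using order_trans [OF _ mult_right_mono [OF _ L2_set_nonneg]] by blast

lemma mat_norm_le:
  assumes "matrix_bound I A C" "0 \<le> C"
  shows "mat_norm I A \<le> C"
  unfolding mat_norm_def
proof (rule cSUP_least)
  show "{\<xi>. (\<Sum>i\<in>I. (norm (\<xi> i :: 'b))\<^sup>2) \<le> 1} \<noteq> {}"
    by (auto intro: exI [of _ "\<lambda>_. 0"])
  fix \<xi> :: "'a \<Rightarrow> 'b" assume "\<xi> \<in> {\<xi>. (\<Sum>i\<in>I. (norm (\<xi> i))\<^sup>2) \<le> 1}"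
  then have "L2_set (\<lambda>i. norm (\<xi> i)) I \<le> 1"
    by (simp add: L2_set_def)
  then have "C * L2_set (\<lambda>i. norm (\<xi> i)) I \<le> C"
    using assms(2) by (simp add: mult_left_le)
  moreover have "L2_set (\<lambda>i. norm (\<Sum>j\<in>I. A i j (\<xi> j))) I \<le> C * L2_set (\<lambda>i. norm (\<xi> i)) I"
    using assms(1) unfolding matrix_bound_def by blast
  ultimately show "sqrt (\<Sum>i\<in>I. (norm (\<Sum>j\<in>I. A i j (\<xi> j)))\<^sup>2) \<le> C"
    unfolding L2_set_def by linarith
qed

lemma mat_norm_bdd_above:
  assumes "finite I" "\<And>i j. i \<in> I \<Longrightarrow> j \<in> I \<Longrightarrow> bounded_linear (A i j)"
  shows "bdd_above ((\<lambda>\<xi>. sqrt (\<Sum>i\<in>I. (norm (\<Sum>j\<in>I. A i j (\<xi> j)))\<^sup>2)) `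
    {\<xi>. (\<Sum>i\<in>I. (norm (\<xi> i))\<^sup>2) \<le> 1})"
proof -
  let ?K = "\<lambda>i j. onorm (A i j)"
  show ?thesis
  proof (rule bdd_aboveI2)
    fix \<xi> :: "'a \<Rightarrow> 'b" assume "\<xi> \<in> {\<xi>. (\<Sum>i\<in>I. (norm (\<xi> i))\<^sup>2) \<le> 1}"
    then have le1: "L2_set (\<lambda>i. norm (\<xi> i)) I \<le> 1"
      by (simp add: L2_set_def)
    have "sqrt (\<Sum>i\<in>I. (norm (\<Sum>j\<in>I. A i j (\<xi> j)))\<^sup>2) \<le> (\<Sum>i\<in>I. norm (\<Sum>j\<in>I. A i j (\<xi> j)))"
      using L2_set_le_sum [of I "\<lambda>i. norm (\<Sum>j\<in>I. A i j (\<xi> j))"] by (simp add: L2_set_def)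
    also have "\<dots> \<le> (\<Sum>i\<in>I. \<Sum>j\<in>I. ?K i j)"
    proof (intro sum_mono order_trans [OF norm_sum])
      fix i j assume ij: "i \<in> I" "j \<in> I"
      have "norm (\<xi> j) \<le> 1"
        using member_le_L2_set [OF assms(1) ij(2), of "\<lambda>i. norm (\<xi> i)"] le1 by simp
      then show "norm (A i j (\<xi> j)) \<le> ?K i j"
        using onorm [OF assms(2) [OF ij], of "\<xi> j"] onorm_pos_le [OF assms(2) [OF ij]]
        by (meson mult_left_le order_trans)
    qed
    finally show "sqrt (\<Sum>i\<in>I. (norm (\<Sum>j\<in>I. A i j (\<xi> j)))\<^sup>2) \<le> (\<Sum>i\<in>I. \<Sum>j\<in>I. ?K i j)" .
  qed
qed

lemma mat_norm_nonneg:
  assumes "finite I" "\<And>i j. i \<in> I \<Longrightarrow> j \<in> I \<Longrightarrow> bounded_linear (A i j)"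
  shows "0 \<le> mat_norm I A"
proof -
  have "sqrt (\<Sum>i\<in>I. (norm (\<Sum>j\<in>I. A i j 0))\<^sup>2) \<le> mat_norm I A"
    unfolding mat_norm_def
    by (rule cSUP_upper2 [OF mat_norm_bdd_above [OF assms], where x = "\<lambda>_. 0"]) auto
  then show ?thesis
    by (smt (verit) real_sqrt_ge_zero sum_nonneg zero_le_power2)
qed

lemma matrix_bound_mat_norm:
  assumes "finite I" "\<And>i j. i \<in> I \<Longrightarrow> j \<in> I \<Longrightarrow> bounded_linear (A i j)"
  shows "matrix_bound I A (mat_norm I A)"
  unfolding matrix_bound_def
proof
  fix \<xi> :: "'a \<Rightarrow> 'b"
  let ?r = "L2_set (\<lambda>i. norm (\<xi> i)) I"
  show "L2_set (\<lambda>i. norm (\<Sum>j\<in>I. A i j (\<xi> j))) I \<le> mat_norm I A * ?r"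
  proof (cases "?r = 0")
    case True
    then have "\<forall>j\<in>I. \<xi> j = 0"
      using L2_set_eq_0_iff [OF assms(1)] by simp
    then have "norm (\<Sum>j\<in>I. A i j (\<xi> j)) = 0" if "i \<in> I" for i
      using that assms(2) by (simp add: linear_0 bounded_linear.linear)
    then show ?thesis
      using True by (simp add: L2_set_0')
  next
    case False
    then have r: "?r > 0"
      using L2_set_nonneg [of "\<lambda>i. norm (\<xi> i)" I] by linarith
    define \<eta> where "\<eta> j = (1 / ?r) *\<^sub>R \<xi> j" for j
    have "L2_set (\<lambda>i. norm (\<eta> i)) I = 1 / ?r * ?r"
      unfolding \<eta>_def norm_scaleR using r by (subst L2_set_right_distrib) auto
    then have "(\<Sum>i\<in>I. (norm (\<eta> i))\<^sup>2) \<le> 1"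
      using r by (simp add: L2_set_def)
    then have "L2_set (\<lambda>i. norm (\<Sum>j\<in>I. A i j (\<eta> j))) I \<le> mat_norm I A"
      unfolding mat_norm_def L2_set_def
      by (intro cSUP_upper [OF _ mat_norm_bdd_above [OF assms]]) auto
    moreover have "L2_set (\<lambda>i. norm (\<Sum>j\<in>I. A i j (\<eta> j))) I =
        1 / ?r * L2_set (\<lambda>i. norm (\<Sum>j\<in>I. A i j (\<xi> j))) I"
    proof -
      have "norm (\<Sum>j\<in>I. A i j (\<eta> j)) = 1 / ?r * norm (\<Sum>j\<in>I. A i j (\<xi> j))" if "i \<in> I" for i
      proof -
        have "(\<Sum>j\<in>I. A i j (\<eta> j)) = (1 / ?r) *\<^sub>R (\<Sum>j\<in>I. A i j (\<xi> j))"
          unfolding \<eta>_def scaleR_sum_right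
          using assms(2) that by (intro sum.cong) (auto simp: linear_scale bounded_linear.linear)
        then show ?thesis
          using r by simp
      qed
      then show ?thesis
        using r by (subst L2_set_right_distrib) (auto intro: L2_set_cong)
    qed
    ultimately show ?thesis
      using r by (simp add: field_simps)
  qed
qed

definition block_bound :: "nat \<Rightarrow> nat \<Rightarrow> (nat \<Rightarrow> nat \<Rightarrow> nat \<Rightarrow> nat \<Rightarrow> complex) \<Rightarrow> real \<Rightarrow> bool" where
  "block_bound m k a C \<longleftrightarrow> (\<forall>\<xi>.
     L2_set (\<lambda>s. cmod (\<Sum>t\<in>{..<m} \<times> {..<k}. a (fst s) (fst t) (snd s) (snd t) * \<xi> t)) ({..<m} \<times> {..<k})
       \<le> C * L2_set (\<lambda>t. cmod (\<xi> t)) ({..<m} \<times> {..<k}))"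

lemma block_norm_le_iff:
  assumes "0 \<le> C"
  shows "block_norm m k a \<le> C \<longleftrightarrow> block_bound m k a C"
proof -
  let ?I = "{..<m} \<times> {..<k}"
  let ?A = "\<lambda>s t z. a (fst s) (fst t) (snd s) (snd t) * z"
  have norm: "block_norm m k a = mat_norm ?I ?A"
    unfolding block_norm_def by (simp add: case_prod_unfold)
  have bound: "block_bound m k a D \<longleftrightarrow> matrix_bound ?I ?A D" for D
    unfolding block_bound_def matrix_bound_def ..
  have "matrix_bound ?I ?A (mat_norm ?I ?A)"
    by (rule matrix_bound_mat_norm) (auto intro: bounded_linear_mult_right)
  then show ?thesis
    unfolding norm bound using mat_norm_le [OF _ assms] matrix_bound_mono by blast
qed

lemma block_norm_nonneg: "0 \<le> block_norm m k a"
  unfolding block_norm_def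
  by (rule mat_norm_nonneg) (auto simp: case_prod_unfold intro: bounded_linear_mult_right)

lemma block_bound_mono: "block_bound m k a C \<Longrightarrow> C \<le> D \<Longrightarrow> block_bound m k a D"
  unfolding block_bound_def
  using order_trans [OF _ mult_right_mono [OF _ L2_set_nonneg]] by blast

lemma block_bound_cong:
  assumes "\<And>i j p q. i < m \<Longrightarrow> j < m \<Longrightarrow> p < k \<Longrightarrow> q < k \<Longrightarrow> a i j p q = b i j p q"
  shows "block_bound m k a C \<longleftrightarrow> block_bound m k b C"
proof -
  have "L2_set (\<lambda>s. cmod (\<Sum>t\<in>{..<m} \<times> {..<k}. a (fst s) (fst t) (snd s) (snd t) * \<xi> t)) ({..<m} \<times> {..<k})
      = L2_set (\<lambda>s. cmod (\<Sum>t\<in>{..<m} \<times> {..<k}. b (fst s) (fst t) (snd s) (snd t) * \<xi> t)) ({..<m} \<times> {..<k})"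
    for \<xi>
    using assms by (intro L2_set_cong refl arg_cong [where f = cmod] sum.cong) auto
  then show ?thesis
    unfolding block_bound_def by simp
qed

lemma block_bound_add:
  assumes "block_bound m k a C" "block_bound m k b D"
  shows "block_bound m k (\<lambda>i j p q. a i j p q + b i j p q) (C + D)"
  unfolding block_bound_def
proof
  fix \<xi> :: "nat \<times> nat \<Rightarrow> complex"
  let ?I = "{..<m} \<times> {..<k}"
  let ?s = "\<lambda>a s. \<Sum>t\<in>?I. a (fst s) (fst t) (snd s) (snd t) * \<xi> t"
  have "?s (\<lambda>i j p q. a i j p q + b i j p q) s = ?s a s + ?s b s" for s
    by (simp add: distrib_right sum.distrib)
  then have "L2_set (\<lambda>s. cmod (?s (\<lambda>i j p q. a i j p q + b i j p q) s)) ?I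
      \<le> L2_set (\<lambda>s. cmod (?s a s) + cmod (?s b s)) ?I"
    by (intro L2_set_mono) (auto intro: norm_triangle_ineq)
  also have "\<dots> \<le> L2_set (\<lambda>s. cmod (?s a s)) ?I + L2_set (\<lambda>s. cmod (?s b s)) ?I"
    by (rule L2_set_triangle_ineq)
  also have "\<dots> \<le> C * L2_set (\<lambda>t. cmod (\<xi> t)) ?I + D * L2_set (\<lambda>t. cmod (\<xi> t)) ?I"
    using assms unfolding block_bound_def by (intro add_mono) auto
  finally show "L2_set (\<lambda>s. cmod (?s (\<lambda>i j p q. a i j p q + b i j p q) s)) ?I
      \<le> (C + D) * L2_set (\<lambda>t. cmod (\<xi> t)) ?I"
    by (simp add: distrib_right)
qed

lemma block_bound_cmult:
  assumes "block_bound m k a C"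
  shows "block_bound m k (\<lambda>i j p q. c * a i j p q) (cmod c * C)"
  unfolding block_bound_def
proof
  fix \<xi> :: "nat \<times> nat \<Rightarrow> complex"
  let ?I = "{..<m} \<times> {..<k}"
  have "(\<Sum>t\<in>?I. c * a (fst s) (fst t) (snd s) (snd t) * \<xi> t) =
      c * (\<Sum>t\<in>?I. a (fst s) (fst t) (snd s) (snd t) * \<xi> t)" for s
    by (simp add: sum_distrib_left mult.assoc)
  then have "L2_set (\<lambda>s. cmod (\<Sum>t\<in>?I. c * a (fst s) (fst t) (snd s) (snd t) * \<xi> t)) ?I
      = cmod c * L2_set (\<lambda>s. cmod (\<Sum>t\<in>?I. a (fst s) (fst t) (snd s) (snd t) * \<xi> t)) ?I"
    by (simp add: norm_mult L2_set_right_distrib)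
  also have "\<dots> \<le> cmod c * (C * L2_set (\<lambda>t. cmod (\<xi> t)) ?I)"
    using assms unfolding block_bound_def by (intro mult_left_mono) auto
  finally show "L2_set (\<lambda>s. cmod (\<Sum>t\<in>?I. c * a (fst s) (fst t) (snd s) (snd t) * \<xi> t)) ?I
      \<le> cmod c * C * L2_set (\<lambda>t. cmod (\<xi> t)) ?I"
    by (simp add: mult.assoc)
qed

lemma block_bound_limit:
  assumes "\<And>N. block_bound m k (a N) C" "\<And>i j p q. i < m \<Longrightarrow> j < m \<Longrightarrow> p < k \<Longrightarrow> q < k \<Longrightarrow>
    (\<lambda>N. a N i j p q) \<longlonglongrightarrow> b i j p q"
  shows "block_bound m k b C"
  unfolding block_bound_def
proof
  fix \<xi> :: "nat \<times> nat \<Rightarrow> complex"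
  let ?I = "{..<m} \<times> {..<k}"
  let ?L = "\<lambda>a. L2_set (\<lambda>s. cmod (\<Sum>t\<in>?I. a (fst s) (fst t) (snd s) (snd t) * \<xi> t)) ?I"
  have "(\<lambda>N. ?L (a N)) \<longlonglongrightarrow> ?L b"
    unfolding L2_set_def by (intro tendsto_intros assms(2)) auto
  then show "?L b \<le> C * L2_set (\<lambda>t. cmod (\<xi> t)) ?I"
    by (rule LIMSEQ_le_const2) (use assms(1) in \<open>auto simp: block_bound_def\<close>)
qed

text \<open>The norm of \<open>M\<^sub>m(M\<^sub>k)\<close> equals that of \<open>M\<^sub>k(M\<^sub>m)\<close>. The lifted matrix \<open>[T y\<^sub>p\<^sub>q]\<close> is measured by its
  values \<open>[T y\<^sub>p\<^sub>q (e\<^sub>i\<^sub>j)]\<close> with the indices of the functions outside, whereas \<open>Lip\<^sub>n\<close> of \<open>[e\<^sub>i\<^sub>j]\<close> has the indices of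
  the points outside.\<close>

lemma block_bound_swap:
  assumes "block_bound m k a C"
  shows "block_bound k m (\<lambda>i j p q. a p q i j) C"
  unfolding block_bound_def
proof
  fix \<xi> :: "nat \<times> nat \<Rightarrow> complex"
  have L2: "L2_set f ({..<k} \<times> {..<m}) = L2_set (\<lambda>s. f (prod.swap s)) ({..<m} \<times> {..<k})"
    for f :: "nat \<times> nat \<Rightarrow> real"
    unfolding L2_set_def
    by (rule arg_cong [where f = sqrt], rule sum.reindex_bij_witness [where i = prod.swap and j = prod.swap]) auto
  have sum: "(\<Sum>t\<in>{..<k} \<times> {..<m}. g t) = (\<Sum>t\<in>{..<m} \<times> {..<k}. g (prod.swap t))"
    for g :: "nat \<times> nat \<Rightarrow> complex"
    by (rule sum.reindex_bij_witness [where i = prod.swap and j = prod.swap]) auto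
  show "L2_set (\<lambda>s. cmod (\<Sum>t\<in>{..<k} \<times> {..<m}. a (snd s) (snd t) (fst s) (fst t) * \<xi> t))
      ({..<k} \<times> {..<m}) \<le> C * L2_set (\<lambda>t. cmod (\<xi> t)) ({..<k} \<times> {..<m})"
    unfolding L2 sum using assms unfolding block_bound_def by simp
qed

lemma L2_set_delta: "finite I \<Longrightarrow> j \<in> I \<Longrightarrow> L2_set (\<lambda>k. if k = j then r else 0) I = \<bar>r\<bar>"
  by (simp add: L2_set_def if_distrib [of "\<lambda>x. x\<^sup>2"] cong: if_cong)

abbreviation op_norm :: "nat \<Rightarrow> (nat \<Rightarrow> nat \<Rightarrow> 'h::real_normed_vector \<Rightarrow>\<^sub>L 'h) \<Rightarrow> real" where
  "op_norm n x \<equiv> mat_norm {..<n} (\<lambda>i j. blinfun_apply (x i j))"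

lemma op_norm_nonneg: "0 \<le> op_norm n x"
  by (rule mat_norm_nonneg) (auto intro: blinfun.bounded_linear_right)

lemma L2_norm_apply_le:
  fixes x :: "nat \<Rightarrow> nat \<Rightarrow> 'h::real_normed_vector \<Rightarrow>\<^sub>L 'h"
  shows "L2_set (\<lambda>i. norm (\<Sum>j<n. x i j (\<xi> j))) {..<n} \<le> op_norm n x * L2_set (\<lambda>i. norm (\<xi> i)) {..<n}"
proof -
  have "matrix_bound {..<n} (\<lambda>i j. blinfun_apply (x i j)) (op_norm n x)"
    by (rule matrix_bound_mat_norm) (auto intro: blinfun.bounded_linear_right)
  then show ?thesis
    unfolding matrix_bound_def by (rule spec)
qed

lemma norm_entry_le_op_norm:
  assumes "i < n" "j < n"
  shows "norm (x i j) \<le> op_norm n x"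
proof (rule norm_blinfun_bound [OF op_norm_nonneg])
  fix z :: 'a
  let ?\<xi> = "\<lambda>k. if k = j then z else 0"
  have "norm (\<Sum>k<n. x i k (?\<xi> k)) \<le> L2_set (\<lambda>i. norm (\<Sum>k<n. x i k (?\<xi> k))) {..<n}"
    using assms by (intro member_le_L2_set) auto
  also have "\<dots> \<le> op_norm n x * L2_set (\<lambda>k. norm (?\<xi> k)) {..<n}"
    by (rule L2_norm_apply_le)
  also have "(\<lambda>k. norm (?\<xi> k)) = (\<lambda>k. if k = j then norm z else 0)"
    by auto
  also have "(\<Sum>k<n. x i k (?\<xi> k)) = x i j z"
    using assms by (simp add: if_distrib [of "blinfun_apply _"] cong: if_cong)
  finally show "norm (x i j z) \<le> op_norm n x * norm z"
    using assms by (simp add: L2_set_delta)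
qed

lemma op_norm_single_entry:
  fixes x :: "'h::real_normed_vector \<Rightarrow>\<^sub>L 'h"
  assumes "0 < n"
  shows "op_norm n (\<lambda>i j. if i = 0 \<and> j = 0 then x else 0) \<le> norm x"
proof (rule mat_norm_le)
  show "matrix_bound {..<n} (\<lambda>i j. blinfun_apply (if i = 0 \<and> j = 0 then x else 0)) (norm x)"
    unfolding matrix_bound_def
  proof
    fix \<xi> :: "nat \<Rightarrow> 'h"
    have "norm (\<Sum>j<n. (if i = 0 \<and> j = 0 then x else 0) (\<xi> j)) =
        (if i = 0 then norm (x (\<xi> 0)) else 0)" for i :: nat
    proof -
      have "(\<Sum>j<n. (if i = 0 \<and> j = 0 then x else 0) (\<xi> j)) =
          (\<Sum>j<n. if j = 0 then if i = 0 then x (\<xi> 0) else 0 else 0)"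
        by (intro sum.cong) auto
      also have "\<dots> = (if i = 0 then x (\<xi> 0) else 0)"
        using assms by (subst sum.delta) auto
      finally show ?thesis
        by simp
    qed
    then have "L2_set (\<lambda>i. norm (\<Sum>j<n. (if i = 0 \<and> j = 0 then x else 0) (\<xi> j))) {..<n}
        = L2_set (\<lambda>i. if i = 0 then norm (x (\<xi> 0)) else 0) {..<n}"
      by (simp only:)
    also have "\<dots> = norm (x (\<xi> 0))"
      using assms by (simp add: L2_set_delta)
    also have "\<dots> \<le> norm x * norm (\<xi> 0)"
      by (rule norm_blinfun)
    also have "\<dots> \<le> norm x * L2_set (\<lambda>i. norm (\<xi> i)) {..<n}"
      using assms by (intro mult_left_mono member_le_L2_set) auto
    finally show "L2_set (\<lambda>i. norm (\<Sum>j<n. (if i = 0 \<and> j = 0 then x else 0) (\<xi> j))) {..<n}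
        \<le> norm x * L2_set (\<lambda>i. norm (\<xi> i)) {..<n}" .
  qed
qed simp

lemma scaleC_zero_right [simp]: "c *\<^sub>C (0::'h::complex_hilbert) = 0"
  using norm_scaleC [of c "0::'h"] by simp

lemma scaleC_sum: "c *\<^sub>C (\<Sum>i\<in>I. f i :: 'h::complex_hilbert) = (\<Sum>i\<in>I. c *\<^sub>C f i)"
  by (induction I rule: infinite_finite_induct) (auto simp: scaleC_add_right)

lemma op_norm_scaleC:
  fixes x :: "nat \<Rightarrow> nat \<Rightarrow> 'h::complex_hilbert \<Rightarrow>\<^sub>L 'h"
  shows "op_norm n (\<lambda>i j. c *\<^sub>C x i j) \<le> cmod c * op_norm n x"
proof (rule mat_norm_le)
  show "matrix_bound {..<n} (\<lambda>i j. blinfun_apply (c *\<^sub>C x i j)) (cmod c * op_norm n x)"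
    unfolding matrix_bound_def
  proof
    fix \<xi> :: "nat \<Rightarrow> 'h"
    have "L2_set (\<lambda>i. norm (\<Sum>j<n. (c *\<^sub>C x i j) (\<xi> j))) {..<n} =
        cmod c * L2_set (\<lambda>i. norm (\<Sum>j<n. x i j (\<xi> j))) {..<n}"
      by (simp add: scaleC_blinfun.rep_eq L2_set_right_distrib norm_scaleC flip: scaleC_sum)
    also have "\<dots> \<le> cmod c * (op_norm n x * L2_set (\<lambda>i. norm (\<xi> i)) {..<n})"
      by (intro mult_left_mono L2_norm_apply_le) simp
    finally show "L2_set (\<lambda>i. norm (\<Sum>j<n. (c *\<^sub>C x i j) (\<xi> j))) {..<n}
        \<le> cmod c * op_norm n x * L2_set (\<lambda>i. norm (\<xi> i)) {..<n}"
      by (simp add: mult.assoc)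
  qed
qed (simp add: op_norm_nonneg)

lemma scaleR_blinfun_scaleC: "r *\<^sub>R (A :: 'h::complex_hilbert \<Rightarrow>\<^sub>L 'h) = complex_of_real r *\<^sub>C A"
  by (rule blinfun_eqI) (simp add: scaleC_blinfun.rep_eq scaleR_blinfun.rep_eq scaleR_scaleC)

lemma scaleC_blinfun_add_right:
  "c *\<^sub>C (A + B :: 'h::complex_hilbert \<Rightarrow>\<^sub>L 'h) = c *\<^sub>C A + c *\<^sub>C B"
  by (rule blinfun_eqI) (simp add: scaleC_blinfun.rep_eq plus_blinfun.rep_eq scaleC_add_right)

lemma scaleC_blinfun_add_left:
  "(c + d) *\<^sub>C (A :: 'h::complex_hilbert \<Rightarrow>\<^sub>L 'h) = c *\<^sub>C A + d *\<^sub>C A"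
  by (rule blinfun_eqI) (simp add: scaleC_blinfun.rep_eq plus_blinfun.rep_eq scaleC_add_left)

lemma scaleC_blinfun_assoc: "c *\<^sub>C d *\<^sub>C (A :: 'h::complex_hilbert \<Rightarrow>\<^sub>L 'h) = (c * d) *\<^sub>C A"
  by (rule blinfun_eqI) (simp add: scaleC_blinfun.rep_eq scaleC_scaleC)

text \<open>The inequality \<open>\<le>\<close> for \<open>c\<close> and for \<open>inverse c\<close> gives equality.\<close>

lemma norm_scaleC_blinfun: "norm (c *\<^sub>C (A :: 'h::complex_hilbert \<Rightarrow>\<^sub>L 'h)) = cmod c * norm A"
proof (rule antisym)
  have le: "norm (c *\<^sub>C (A :: 'h \<Rightarrow>\<^sub>L 'h)) \<le> cmod c * norm A" for c A
    by (rule norm_blinfun_bound)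
      (auto simp: scaleC_blinfun.rep_eq norm_scaleC mult.assoc intro!: mult_left_mono norm_blinfun)
  show "norm (c *\<^sub>C A) \<le> cmod c * norm A"
    by (rule le)
  show "cmod c * norm A \<le> norm (c *\<^sub>C A)"
  proof (cases "c = 0")
    case False
    have "1 *\<^sub>C A = A"
      using scaleR_blinfun_scaleC [of 1 A] by simp
    then have "norm A \<le> cmod (inverse c) * norm (c *\<^sub>C A)"
      using le [of "inverse c" "c *\<^sub>C A"] False by (simp add: scaleC_blinfun_assoc)
    then show ?thesis
      using False by (simp add: norm_inverse norm_divide field_simps)
  qed simp
qed

section \<open>Families that are Lipschitz on the matrices of order n\<close>

text \<open>The inequality \<open>Lip\<^sub>n \<le> r\<close> for the map \<open>x \<mapsto> [f\<^sub>p\<^sub>q(x)]\<close>, without quotients.\<close>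

definition n_lipschitz ::
  "real \<Rightarrow> nat \<Rightarrow> ('h::complex_hilbert \<Rightarrow>\<^sub>L 'h) set \<Rightarrow> nat \<Rightarrow> (nat \<Rightarrow> nat \<Rightarrow> ('h \<Rightarrow>\<^sub>L 'h) \<Rightarrow> complex) \<Rightarrow> bool" where
  "n_lipschitz r n X m f \<longleftrightarrow> (\<forall>x\<in>mats n X. \<forall>y\<in>mats n X.
     block_bound n m (\<lambda>i j p q. f p q (x i j) - f p q (y i j)) (r * op_norm n (\<lambda>i j. x i j - y i j)))"

lemma Lip_mnorm_le_iff:
  assumes "0 \<le> r"
  shows "Lip_mnorm n X m f \<le> ennreal r \<longleftrightarrow> n_lipschitz r n X m f"
proof -
  have "ennreal (block_norm n m (\<lambda>i j p q. f p q (x i j) - f p q (y i j)) / op_norm n (\<lambda>i j. x i j - y i j))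
      \<le> ennreal r \<longleftrightarrow>
      block_bound n m (\<lambda>i j p q. f p q (x i j) - f p q (y i j)) (r * op_norm n (\<lambda>i j. x i j - y i j))"
    (is "ennreal (?b / ?d) \<le> _ \<longleftrightarrow> _") for x y
  (* The quotient is then 0 by convention, and the inequality without quotient holds as well since
     x and y have the same entries. *)
  proof (cases "?d = 0")
    case True
    have "x i j = y i j" if "i < n" "j < n" for i j
      using norm_entry_le_op_norm [OF that, of "\<lambda>i j. x i j - y i j"] True by simp
    then have "block_bound n m (\<lambda>i j p q. f p q (x i j) - f p q (y i j)) 0 \<longleftrightarrow>
        block_bound n m (\<lambda>i j p q. 0) 0"
      by (intro block_bound_cong) simp
    also have "block_bound n m (\<lambda>i j p q. 0) 0"
      by (simp add: block_bound_def L2_set_def)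
    finally show ?thesis
      by (simp add: True)
  next
    case False
    then have "?d > 0"
      using op_norm_nonneg [of n "\<lambda>i j. x i j - y i j"] by linarith
    then show ?thesis
      using assms by (simp add: ennreal_le_iff pos_divide_le_eq block_norm_le_iff [symmetric])
  qed
  then show ?thesis
    unfolding Lip_mnorm_def SUP_le_iff n_lipschitz_def by simp
qed

text \<open>Compare \<open>x\<close> and \<open>y\<close> as entries at \<open>(0, 0)\<close> of matrices that vanish elsewhere: this bounds the
  scalar matrix \<open>[f\<^sub>p\<^sub>q(x) - f\<^sub>p\<^sub>q(y)]\<close>, and the Cauchy-Schwarz inequality bounds its bilinear form at
  \<open>\<eta>\<close> and \<open>\<xi>\<close>.\<close>

lemma n_lipschitz_compress:
  assumes "n_lipschitz r n X m f" "0 < n" "0 \<in> X" "0 \<le> r"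
  shows "(L2_set (\<lambda>p. cmod (\<eta> p)) {..<m} * L2_set (\<lambda>q. cmod (\<xi> q)) {..<m} * r)-lipschitz_on X
    (\<lambda>x. \<Sum>p<m. \<Sum>q<m. \<eta> p * \<xi> q * f p q x)"
proof (rule lipschitz_onI)
  fix x y assume xy: "x \<in> X" "y \<in> X"
  define single where "single z = (\<lambda>(i::nat) (j::nat). if i = 0 \<and> j = 0 then z else 0 :: 'a \<Rightarrow>\<^sub>L 'a)" for z
  let ?I = "{..<n} \<times> {..<m}"
  let ?d = "\<lambda>p q. f p q x - f p q y"
  define \<xi>' where "\<xi>' t = (if fst t = 0 then \<xi> (snd t) else 0)" for t :: "nat \<times> nat"
  define a where "a i j p q = f p q (single x i j) - f p q (single y i j)" for i j p q
  have a00: "a 0 0 p q = ?d p q" for p q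
    by (simp add: a_def single_def)
  have slice: "(\<Sum>t\<in>?I. g t) = (\<Sum>q<m. g (0, q))" if "\<And>i q. i > 0 \<Longrightarrow> g (i, q) = 0"
    for g :: "nat \<times> nat \<Rightarrow> 'z::comm_monoid_add"
  proof -
    have "(\<Sum>t\<in>?I. g t) = (\<Sum>i<n. \<Sum>q<m. g (i, q))"
      by (simp add: sum.cartesian_product)
    also have "\<dots> = (\<Sum>i<n. if i = 0 then \<Sum>q<m. g (0, q) else 0)"
      by (intro sum.cong) (auto simp: that)
    finally show ?thesis
      using assms(2) by (simp add: sum.delta)
  qed
  have "single x \<in> mats n X" "single y \<in> mats n X"
    using xy assms(3) by (auto simp: mats_def single_def)
  then have "block_bound n m a (r * op_norm n (\<lambda>i j. single x i j - single y i j))"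
    using assms(1) unfolding n_lipschitz_def a_def by blast
  moreover have "(\<lambda>i j. single x i j - single y i j) = single (x - y)"
    by (auto simp: single_def fun_eq_iff)
  moreover have "r * op_norm n (single (x - y)) \<le> r * norm (x - y)"
    using op_norm_single_entry [OF assms(2), of "x - y"] assms(4)
    unfolding single_def by (rule mult_left_mono)
  ultimately have "block_bound n m a (r * norm (x - y))"
    using block_bound_mono by metis
  then have "L2_set (\<lambda>s. cmod (\<Sum>t\<in>?I. a (fst s) (fst t) (snd s) (snd t) * \<xi>' t)) ?I
      \<le> r * norm (x - y) * L2_set (\<lambda>t. cmod (\<xi>' t)) ?I"
    unfolding block_bound_def by blast
  also have "L2_set (\<lambda>t. cmod (\<xi>' t)) ?I = L2_set (\<lambda>q. cmod (\<xi> q)) {..<m}"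
    unfolding L2_set_def by (subst slice) (auto simp: \<xi>'_def)
  finally have 1: "L2_set (\<lambda>s. cmod (\<Sum>t\<in>?I. a (fst s) (fst t) (snd s) (snd t) * \<xi>' t)) ?I
      \<le> r * norm (x - y) * L2_set (\<lambda>q. cmod (\<xi> q)) {..<m}" .
  have "L2_set (\<lambda>p. cmod (\<Sum>q<m. ?d p q * \<xi> q)) {..<m} \<le>
      L2_set (\<lambda>s. cmod (\<Sum>t\<in>?I. a (fst s) (fst t) (snd s) (snd t) * \<xi>' t)) ?I"
  proof -
    have "(\<Sum>p<m. (cmod (\<Sum>q<m. ?d p q * \<xi> q))\<^sup>2) =
        (\<Sum>s\<in>Pair 0 ` {..<m}. (cmod (\<Sum>t\<in>?I. a (fst s) (fst t) (snd s) (snd t) * \<xi>' t))\<^sup>2)"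
      by (subst sum.reindex) (auto simp: inj_on_def slice \<xi>'_def a00)
    also have "\<dots> \<le> (\<Sum>s\<in>?I. (cmod (\<Sum>t\<in>?I. a (fst s) (fst t) (snd s) (snd t) * \<xi>' t))\<^sup>2)"
      using assms(2) by (intro sum_mono2) auto
    finally show ?thesis
      unfolding L2_set_def by (rule real_sqrt_le_mono)
  qed
  then have 2: "L2_set (\<lambda>p. cmod (\<Sum>q<m. ?d p q * \<xi> q)) {..<m} \<le>
      r * norm (x - y) * L2_set (\<lambda>q. cmod (\<xi> q)) {..<m}"
    using 1 by linarith
  have "(\<Sum>p<m. \<Sum>q<m. \<eta> p * \<xi> q * f p q x) - (\<Sum>p<m. \<Sum>q<m. \<eta> p * \<xi> q * f p q y) =
      (\<Sum>p<m. \<eta> p * (\<Sum>q<m. ?d p q * \<xi> q))"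
    by (simp add: sum_distrib_left algebra_simps sum_subtractf)
  also have "cmod \<dots> \<le> (\<Sum>p<m. \<bar>cmod (\<eta> p)\<bar> * \<bar>cmod (\<Sum>q<m. ?d p q * \<xi> q)\<bar>)"
    by (intro order_trans [OF norm_sum] sum_mono) (simp add: norm_mult)
  also have "\<dots> \<le> L2_set (\<lambda>p. cmod (\<eta> p)) {..<m} * L2_set (\<lambda>p. cmod (\<Sum>q<m. ?d p q * \<xi> q)) {..<m}"
    by (rule L2_set_mult_ineq)
  also have "\<dots> \<le> L2_set (\<lambda>p. cmod (\<eta> p)) {..<m} * (r * norm (x - y) * L2_set (\<lambda>q. cmod (\<xi> q)) {..<m})"
    by (intro mult_left_mono 2) simp
  finally show "dist (\<Sum>p<m. \<Sum>q<m. \<eta> p * \<xi> q * f p q x) (\<Sum>p<m. \<Sum>q<m. \<eta> p * \<xi> q * f p q y)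
      \<le> L2_set (\<lambda>p. cmod (\<eta> p)) {..<m} * L2_set (\<lambda>q. cmod (\<xi> q)) {..<m} * r * dist x y"
    by (simp add: dist_norm mult_ac)
qed (simp add: assms(4))

text \<open>Translating both matrices by the same edge in every entry does not change their difference,
  so the bound holds for each translate of \<open>f\<close> and hence for means.\<close>

lemma n_lipschitz_cube_avg:
  fixes X :: "('h::complex_hilbert \<Rightarrow>\<^sub>L 'h) set"
  assumes "finite I" "subspace X" "\<And>i. i \<in> I \<Longrightarrow> v i \<in> X" "n_lipschitz 1 n X m f"
  shows "n_lipschitz 1 n X m (\<lambda>p q. cube_avg v I (f p q))"
  using assms(1,3)
proof (induction I)
  case empty
  then show ?case
    using assms(4) by (simp add: n_lipschitz_def)
next
  case (insert i I)
  then have IH: "n_lipschitz 1 n X m (\<lambda>p q. cube_avg v I (f p q))" and vi: "v i \<in> X"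
    by auto
  show ?case
    unfolding n_lipschitz_def
  proof (intro ballI)
    fix x y assume xy: "x \<in> mats n X" "y \<in> mats n X"
    let ?F = "\<lambda>p q. cube_avg v I (f p q)" and ?d = "op_norm n (\<lambda>i j. x i j - y i j)"
    have shifted: "(\<lambda>k l. x k l + v i) \<in> mats n X" "(\<lambda>k l. y k l + v i) \<in> mats n X"
      using xy vi assms(2) by (auto simp: mats_def subspace_add)
    have "block_bound n m (\<lambda>k l p q. ?F p q (x k l) - ?F p q (y k l)) ?d"
      using IH xy unfolding n_lipschitz_def by simp
    moreover have "block_bound n m (\<lambda>k l p q. ?F p q (x k l + v i) - ?F p q (y k l + v i)) ?d"
      using bspec [OF bspec [OF IH [unfolded n_lipschitz_def] shifted(1)] shifted(2)] by simp
    ultimately have "block_bound n m (\<lambda>k l p q. 1/2 * ((?F p q (x k l) - ?F p q (y k l)) +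
        (?F p q (x k l + v i) - ?F p q (y k l + v i)))) (cmod (1/2) * (?d + ?d))"
      by (intro block_bound_cmult block_bound_add)
    moreover have "(\<lambda>k l p q. 1/2 * ((?F p q (x k l) - ?F p q (y k l)) +
        (?F p q (x k l + v i) - ?F p q (y k l + v i)))) =
        (\<lambda>k l p q. cube_avg v (insert i I) (f p q) (x k l) - cube_avg v (insert i I) (f p q) (y k l))"
      using insert by (simp add: fun_eq_iff cube_avg_insert algebra_simps flip: add_divide_distrib diff_divide_distrib)
    ultimately show "block_bound n m (\<lambda>k l p q. cube_avg v (insert i I) (f p q) (x k l) -
        cube_avg v (insert i I) (f p q) (y k l)) (1 * ?d)"
      by simp
  qed
qed

section \<open>Norms of functionals in the Lipschitz-free space\<close>

lemma scaleC_fun_apply [simp]: "(c *\<^sub>C \<phi>) f = c * (\<phi> f :: complex)"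
  by (simp add: scaleC_fun_def scaleC_complex_def)

lemma Lip0_add: "f \<in> Lip0 X \<Longrightarrow> g \<in> Lip0 X \<Longrightarrow> f + g \<in> Lip0 X"
  unfolding Lip0_def plus_fun_def by (auto intro: lipschitz_on_add)

lemma Lip0_scaleC: "f \<in> Lip0 X \<Longrightarrow> c *\<^sub>C f \<in> Lip0 X"
proof -
  assume f: "f \<in> Lip0 X"
  then obtain L where L: "L-lipschitz_on X f"
    by (auto simp: Lip0_def)
  have "(cmod c * L)-lipschitz_on X (c *\<^sub>C f)"
  proof (rule lipschitz_onI)
    fix x y assume "x \<in> X" "y \<in> X"
    then show "dist ((c *\<^sub>C f) x) ((c *\<^sub>C f) y) \<le> cmod c * L * dist x y"
      using mult_left_mono [OF lipschitz_on_normD [OF L], of x y "cmod c"]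
      by (simp add: dist_norm norm_mult mult.assoc flip: right_diff_distrib)
  qed (use lipschitz_on_nonneg [OF L] in simp)
  then show ?thesis
    using f by (auto simp: Lip0_def)
qed

lemma Lip0_zero: "0 \<in> Lip0 X"
  using lipschitz_on_constant by (force simp: Lip0_def zero_fun_def)

lemma clinear_on_Lip0_sum:
  assumes "clinear_on (Lip0 X) \<phi>" "finite I" "\<And>i. i \<in> I \<Longrightarrow> f i \<in> Lip0 X"
  shows "(\<lambda>x. \<Sum>i\<in>I. c i * f i x) \<in> Lip0 X \<and>
    \<phi> (\<lambda>x. \<Sum>i\<in>I. c i * f i x) = (\<Sum>i\<in>I. c i * (\<phi> (f i) :: complex))"
  using assms(2,3)
proof (induction I)
  case empty
  have "\<phi> (0 *\<^sub>C 0) = 0 *\<^sub>C \<phi> 0"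
    using assms(1) Lip0_zero unfolding clinear_on_def by blast
  moreover have "0 *\<^sub>C 0 = (0 :: ('a \<Rightarrow>\<^sub>L 'a) \<Rightarrow> complex)"
    by (simp add: fun_eq_iff)
  ultimately have "\<phi> 0 = 0"
    by (simp add: scaleC_complex_def)
  then show ?case
    using Lip0_zero [of X] by (simp add: zero_fun_def)
next
  case (insert i I)
  let ?g = "\<lambda>x. \<Sum>i\<in>I. c i * f i x"
  have eq: "(\<lambda>x. \<Sum>i\<in>insert i I. c i * f i x) = c i *\<^sub>C f i + ?g"
    using insert by (simp add: fun_eq_iff)
  have in1: "c i *\<^sub>C f i \<in> Lip0 X" and in2: "?g \<in> Lip0 X"
    using insert by (auto intro: Lip0_scaleC)
  have "\<phi> (c i *\<^sub>C f i + ?g) = \<phi> (c i *\<^sub>C f i) + \<phi> ?g"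
    using assms(1) in1 in2 unfolding clinear_on_def by blast
  moreover have "\<phi> (c i *\<^sub>C f i) = c i * \<phi> (f i)"
    using assms(1) insert(4) unfolding clinear_on_def by (simp add: scaleC_complex_def)
  ultimately show ?case
    unfolding eq using insert Lip0_add [OF in1 in2] by simp
qed

lemma sum_times_singleton: "(\<Sum>t\<in>{..<m} \<times> {..<Suc 0}. g t) = (\<Sum>i<m. g (i, 0))"
proof -
  have "(\<Sum>t\<in>{..<m} \<times> {..<Suc 0}. g t) = (\<Sum>i<m. \<Sum>q<Suc 0. g (i, q))"
    by (simp only: sum.cartesian_product case_prod_eta)
  then show ?thesis
    by simp
qed

lemma L2_set_times_singleton: "L2_set g ({..<m} \<times> {..<Suc 0}) = L2_set (\<lambda>i. g (i, 0)) {..<m}"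
  unfolding L2_set_def sum_times_singleton ..

text \<open>For a single functional the completely bounded norm is no larger than the norm. With
  \<open>v = [\<phi>(e\<^sub>i\<^sub>j)] \<xi>\<close>, the number \<open>\<parallel>v\<parallel>\<^sup>2\<close> is the value of \<open>\<phi>\<close> at the compression of \<open>[e\<^sub>i\<^sub>j]\<close> by \<open>v\<close> and \<open>\<xi>\<close>, a
  function with Lipschitz constant at most \<open>\<parallel>v\<parallel> \<parallel>\<xi>\<parallel>\<close>.\<close>

lemma free_mnorm_le:
  assumes "clinear_on (Lip0 X) \<phi>" "0 \<le> C" "0 < n" "0 \<in> X"
    and bound: "\<And>f L. f \<in> Lip0 X \<Longrightarrow> L-lipschitz_on X f \<Longrightarrow> cmod (\<phi> f) \<le> C * L"
  shows "free_mnorm n X 1 (\<lambda>_ _. \<phi>) \<le> ennreal C"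
  unfolding free_mnorm_def dual_mnorm_def
proof (intro SUP_least)
  fix m e assume "e \<in> {e \<in> mats m (Lip0 X). Lip_mnorm n X m e \<le> 1}"
  then have e: "\<And>i j. i < m \<Longrightarrow> j < m \<Longrightarrow> e i j \<in> Lip0 X" and lip: "n_lipschitz 1 n X m e"
    using Lip_mnorm_le_iff [of 1 n X m e] by (auto simp: mats_def)
  have "block_bound m 1 (\<lambda>i j p q. \<phi> (e i j)) C"
    unfolding block_bound_def
  proof
    fix \<xi> :: "nat \<times> nat \<Rightarrow> complex"
    define v where "v i = (\<Sum>j<m. \<phi> (e i j) * \<xi> (j, 0))" for i
    let ?v = "L2_set (\<lambda>i. cmod (v i)) {..<m}" and ?\<xi> = "L2_set (\<lambda>j. cmod (\<xi> (j, 0))) {..<m}"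
    define F where "F = (\<lambda>x. \<Sum>i<m. \<Sum>j<m. cnj (v i) * \<xi> (j, 0) * e i j x)"
    have F: "F = (\<lambda>x. \<Sum>t\<in>{..<m} \<times> {..<m}. cnj (v (fst t)) * \<xi> (snd t, 0) * e (fst t) (snd t) x)"
      unfolding F_def sum.cartesian_product by (simp add: case_prod_unfold)
    have "F \<in> Lip0 X \<and>
        \<phi> F = (\<Sum>t\<in>{..<m} \<times> {..<m}. cnj (v (fst t)) * \<xi> (snd t, 0) * \<phi> (e (fst t) (snd t)))"
      unfolding F by (rule clinear_on_Lip0_sum [OF assms(1)]) (auto intro: e)
    moreover have "(\<Sum>t\<in>{..<m} \<times> {..<m}. cnj (v (fst t)) * \<xi> (snd t, 0) * \<phi> (e (fst t) (snd t))) =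
        (\<Sum>i<m. \<Sum>j<m. cnj (v i) * \<xi> (j, 0) * \<phi> (e i j))"
      unfolding sum.cartesian_product by (simp add: case_prod_unfold)
    moreover have "cnj (v i) * v i = (\<Sum>j<m. cnj (v i) * \<xi> (j, 0) * \<phi> (e i j))" for i
      by (subst (2) v_def) (simp add: sum_distrib_left mult_ac)
    ultimately have F_in: "F \<in> Lip0 X" and \<phi>F: "\<phi> F = (\<Sum>i<m. cnj (v i) * v i)"
      by auto
    have "(L2_set (\<lambda>i. cmod (cnj (v i))) {..<m} * ?\<xi> * 1)-lipschitz_on X F"
      unfolding F_def by (rule n_lipschitz_compress [OF lip assms(3,4)]) simp
    then have "cmod (\<phi> F) \<le> C * (?v * ?\<xi>)"
      using bound [OF F_in] by simp
    moreover have "\<phi> F = complex_of_real (?v\<^sup>2)"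
      unfolding \<phi>F L2_set_def
      by (simp add: sum_nonneg mult.commute [of "cnj _"] complex_norm_square del: of_real_power)
    ultimately have "?v * ?v \<le> ?v * (C * ?\<xi>)"
      by (simp add: norm_mult power2_eq_square mult_ac)
    then have "?v \<le> C * ?\<xi>"
      using mult_nonneg_nonneg [OF assms(2), of ?\<xi>]
      by (metis L2_set_nonneg less_eq_real_def mult_le_cancel_left_pos)
    then show "L2_set (\<lambda>s. cmod (\<Sum>t\<in>{..<m} \<times> {..<1::nat}. \<phi> (e (fst s) (fst t)) * \<xi> t)) ({..<m} \<times> {..<1::nat})
        \<le> C * L2_set (\<lambda>t. cmod (\<xi> t)) ({..<m} \<times> {..<1::nat})"
      unfolding One_nat_def sum_times_singleton L2_set_times_singleton by (simp add: v_def)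
  qed
  then show "ennreal (block_norm m 1 (\<lambda>i j p q. \<phi> (e i j))) \<le> ennreal C"
    using assms(2) by (simp add: ennreal_leI block_norm_le_iff)
qed

lemma norm_le_free_mnorm:
  assumes "f \<in> Lip0 X" "n_lipschitz 1 n X 1 (\<lambda>_ _. f)"
  shows "ennreal (cmod (\<phi> f)) \<le> free_mnorm n X 1 (\<lambda>_ _. \<phi>)"
proof -
  let ?b = "block_norm 1 1 (\<lambda>i j p q. \<phi> f)"
  have "0 \<le> ?b"
    by (rule block_norm_nonneg)
  then have "block_bound 1 1 (\<lambda>i j p q. \<phi> f) ?b"
    using block_norm_le_iff by blast
  from spec [OF this [unfolded block_bound_def], of "\<lambda>_. 1"]
  have "cmod (\<phi> f) \<le> ?b"
    by (simp add: sum_times_singleton L2_set_times_singleton lessThan_Suc)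
  then have "ennreal (cmod (\<phi> f)) \<le> ennreal ?b"
    by (rule ennreal_leI)
  also have "\<dots> \<le> free_mnorm n X 1 (\<lambda>_ _. \<phi>)"
    unfolding free_mnorm_def dual_mnorm_def
    using assms Lip_mnorm_le_iff [of 1 n X 1 "\<lambda>_ _. f"]
    by (intro SUP_upper2 [of 1] SUP_upper2 [of "\<lambda>_ _. f"]) (auto simp: mats_def)
  finally show ?thesis .
qed

lemma free_mnorm_add:
  "free_mnorm n X 1 (\<lambda>_ _. \<phi> + \<psi>) \<le> free_mnorm n X 1 (\<lambda>_ _. \<phi>) + free_mnorm n X 1 (\<lambda>_ _. \<psi>)"
  unfolding free_mnorm_def dual_mnorm_def [of _ _ _ "\<lambda>_ _. \<phi> + \<psi>"]
proof (intro SUP_least)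
  fix m e assume e: "e \<in> {e \<in> mats m (Lip0 X). Lip_mnorm n X m e \<le> 1}"
  let ?b = "\<lambda>\<phi>. block_norm m 1 (\<lambda>i j p q. \<phi> (e i j))"
  have nonneg: "0 \<le> ?b \<phi>" for \<phi>
    by (rule block_norm_nonneg)
  have "block_bound m 1 (\<lambda>i j p q. \<phi> (e i j) + \<psi> (e i j)) (?b \<phi> + ?b \<psi>)"
    using block_norm_le_iff nonneg by (intro block_bound_add) blast+
  then have "?b (\<phi> + \<psi>) \<le> ?b \<phi> + ?b \<psi>"
    using nonneg [of \<phi>] nonneg [of \<psi>] by (simp add: block_norm_le_iff)
  then have "ennreal (?b (\<phi> + \<psi>)) \<le> ennreal (?b \<phi>) + ennreal (?b \<psi>)"
    using nonneg by (simp add: ennreal_leI flip: ennreal_plus)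
  also have "\<dots> \<le> dual_mnorm (Lip0 X) (Lip_mnorm n X) 1 (\<lambda>_ _. \<phi>)
      + dual_mnorm (Lip0 X) (Lip_mnorm n X) 1 (\<lambda>_ _. \<psi>)"
    unfolding dual_mnorm_def
    using e by (intro add_mono SUP_upper2 [of m] SUP_upper2 [of e]) auto
  finally show "ennreal (?b (\<phi> + \<psi>)) \<le> dual_mnorm (Lip0 X) (Lip_mnorm n X) 1 (\<lambda>_ _. \<phi>)
      + dual_mnorm (Lip0 X) (Lip_mnorm n X) 1 (\<lambda>_ _. \<psi>)" .
qed

lemma free_mnorm_scaleC:
  "free_mnorm n X 1 (\<lambda>_ _. c *\<^sub>C \<phi>) \<le> ennreal (cmod c) * free_mnorm n X 1 (\<lambda>_ _. \<phi>)"
  unfolding free_mnorm_def dual_mnorm_def [of _ _ _ "\<lambda>_ _. c *\<^sub>C \<phi>"]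
proof (intro SUP_least)
  fix m e assume e: "e \<in> {e \<in> mats m (Lip0 X). Lip_mnorm n X m e \<le> 1}"
  let ?b = "\<lambda>\<phi>. block_norm m 1 (\<lambda>i j p q. \<phi> (e i j))"
  have nonneg: "0 \<le> ?b \<phi>"
    by (rule block_norm_nonneg)
  have "block_bound m 1 (\<lambda>i j p q. c * \<phi> (e i j)) (cmod c * ?b \<phi>)"
    using block_norm_le_iff nonneg by (intro block_bound_cmult) blast
  then have "?b (c *\<^sub>C \<phi>) \<le> cmod c * ?b \<phi>"
    using nonneg by (simp add: block_norm_le_iff)
  then have "ennreal (?b (c *\<^sub>C \<phi>)) \<le> ennreal (cmod c) * ennreal (?b \<phi>)"
    using nonneg by (simp add: ennreal_leI flip: ennreal_mult)
  also have "\<dots> \<le> ennreal (cmod c) * dual_mnorm (Lip0 X) (Lip_mnorm n X) 1 (\<lambda>_ _. \<phi>)"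
    unfolding dual_mnorm_def
    using e by (intro mult_left_mono SUP_upper2 [of m] SUP_upper2 [of e]) auto
  finally show "ennreal (?b (c *\<^sub>C \<phi>)) \<le>
      ennreal (cmod c) * dual_mnorm (Lip0 X) (Lip_mnorm n X) 1 (\<lambda>_ _. \<phi>)" .
qed

text \<open>A condition sufficient for membership in the dual, in which the bound refers to the ordinary
  Lipschitz constant and to no \<open>n\<close>.\<close>

definition lipschitz_functional ::
  "('h::complex_hilbert \<Rightarrow>\<^sub>L 'h) set \<Rightarrow> ((('h \<Rightarrow>\<^sub>L 'h) \<Rightarrow> complex) \<Rightarrow> complex) \<Rightarrow> bool" where
  "lipschitz_functional X \<phi> \<longleftrightarrow> clinear_on (Lip0 X) \<phi> \<and> (\<forall>f. f \<notin> Lip0 X \<longrightarrow> \<phi> f = 0) \<and>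
     (\<exists>C\<ge>0. \<forall>f\<in>Lip0 X. \<forall>L. L-lipschitz_on X f \<longrightarrow> cmod (\<phi> f) \<le> C * L)"

lemma lipschitz_functional_in_dual:
  assumes "lipschitz_functional X \<phi>" "0 < n" "0 \<in> X"
  shows "\<phi> \<in> dual (Lip0 X) (Lip_mnorm n X)"
proof -
  obtain C where C: "C \<ge> 0" "\<And>f L. f \<in> Lip0 X \<Longrightarrow> L-lipschitz_on X f \<Longrightarrow> cmod (\<phi> f) \<le> C * L"
    using assms(1) unfolding lipschitz_functional_def by blast
  (* A positive factor, also for C = 0, makes the right-hand side infinite whenever Lip_mnorm is. *)
  have "ennreal (cmod (\<phi> f)) \<le> ennreal (C + 1) * Lip_mnorm n X 1 (\<lambda>_ _. f)" if f: "f \<in> Lip0 X" for f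
  proof (cases "Lip_mnorm n X 1 (\<lambda>_ _. f)")
    case (real r)
    then have "n_lipschitz r n X 1 (\<lambda>_ _. f)"
      using Lip_mnorm_le_iff [of r n X 1 "\<lambda>_ _. f"] by simp
    from n_lipschitz_compress [OF this assms(2,3) real(1), of "\<lambda>_. 1" "\<lambda>_. 1"]
    have "r-lipschitz_on X f"
      by (simp add: lessThan_Suc)
    then have "cmod (\<phi> f) \<le> C * r"
      by (rule C(2) [OF f])
    also have "\<dots> \<le> (C + 1) * r"
      using real(1) by (simp add: distrib_right)
    finally have "ennreal (cmod (\<phi> f)) \<le> ennreal ((C + 1) * r)"
      by (rule ennreal_leI)
    then show ?thesis
      unfolding real(2) using real(1) C(1) by (simp only: ennreal_mult)
  next
    case top
    then show ?thesis
      using C(1) by (simp add: ennreal_mult_top)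
  qed
  then show ?thesis
    using assms(1) unfolding dual_def lipschitz_functional_def by auto
qed

lemma lipschitz_functional_zero: "lipschitz_functional X 0"
  unfolding lipschitz_functional_def clinear_on_def
  by (auto simp: scaleC_complex_def intro!: exI [of _ 0])

lemma lipschitz_functional_add:
  assumes "lipschitz_functional X \<phi>" "lipschitz_functional X \<psi>"
  shows "lipschitz_functional X (\<phi> + \<psi>)"
proof -
  obtain C where C: "C \<ge> 0" "\<And>f L. f \<in> Lip0 X \<Longrightarrow> L-lipschitz_on X f \<Longrightarrow> cmod (\<phi> f) \<le> C * L"
    using assms(1) unfolding lipschitz_functional_def by blast
  obtain D where D: "D \<ge> 0" "\<And>f L. f \<in> Lip0 X \<Longrightarrow> L-lipschitz_on X f \<Longrightarrow> cmod (\<psi> f) \<le> D * L"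
    using assms(2) unfolding lipschitz_functional_def by blast
  have "cmod ((\<phi> + \<psi>) f) \<le> (C + D) * L" if "f \<in> Lip0 X" "L-lipschitz_on X f" for f L
    using norm_triangle_ineq [of "\<phi> f" "\<psi> f"] C(2) [OF that] D(2) [OF that]
    by (simp add: distrib_right)
  then have "\<exists>E\<ge>0. \<forall>f\<in>Lip0 X. \<forall>L. L-lipschitz_on X f \<longrightarrow> cmod ((\<phi> + \<psi>) f) \<le> E * L"
    using C(1) D(1) by (intro exI [of _ "C + D"]) auto
  then show ?thesis
    using assms unfolding lipschitz_functional_def clinear_on_def
    by (auto simp: scaleC_complex_def algebra_simps)
qed

lemma lipschitz_functional_scaleC:
  assumes "lipschitz_functional X \<phi>"
  shows "lipschitz_functional X (c *\<^sub>C \<phi>)"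
proof -
  obtain C where C: "C \<ge> 0" "\<And>f L. f \<in> Lip0 X \<Longrightarrow> L-lipschitz_on X f \<Longrightarrow> cmod (\<phi> f) \<le> C * L"
    using assms(1) unfolding lipschitz_functional_def by blast
  have "cmod ((c *\<^sub>C \<phi>) f) \<le> cmod c * C * L" if "f \<in> Lip0 X" "L-lipschitz_on X f" for f L
    using mult_left_mono [OF C(2) [OF that], of "cmod c"] by (simp add: norm_mult mult.assoc)
  then have "\<exists>E\<ge>0. \<forall>f\<in>Lip0 X. \<forall>L. L-lipschitz_on X f \<longrightarrow> cmod ((c *\<^sub>C \<phi>) f) \<le> E * L"
    using C(1) by (intro exI [of _ "cmod c * C"]) auto
  then show ?thesis
    using assms unfolding lipschitz_functional_def clinear_on_def
    by (auto simp: scaleC_complex_def algebra_simps)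
qed

lemma lipschitz_functional_evaluation:
  assumes "x \<in> X" "0 \<in> X"
  shows "lipschitz_functional X (evaluation X x)"
proof -
  have "cmod (evaluation X x f) \<le> norm x * L" if "f \<in> Lip0 X" "L-lipschitz_on X f" for f L
    using lipschitz_on_normD [OF that(2) assms] that(1)
    by (simp add: evaluation_def Lip0_def mult.commute)
  then have "\<exists>C\<ge>0. \<forall>f\<in>Lip0 X. \<forall>L. L-lipschitz_on X f \<longrightarrow> cmod (evaluation X x f) \<le> C * L"
    by (intro exI [of _ "norm x"]) auto
  then show ?thesis
    unfolding lipschitz_functional_def clinear_on_def
    by (auto simp: evaluation_def Lip0_add Lip0_scaleC scaleC_complex_def)
qed

lemma lipschitz_functional_diff:
  assumes "lipschitz_functional X \<phi>" "lipschitz_functional X \<psi>"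
  shows "lipschitz_functional X (\<phi> - \<psi>)"
proof -
  have "\<phi> - \<psi> = \<phi> + (- 1) *\<^sub>C \<psi>"
    by (simp add: fun_eq_iff)
  then show ?thesis
    using assms by (simp only: lipschitz_functional_add lipschitz_functional_scaleC)
qed

lemma evaluation_in_span: "x \<in> X \<Longrightarrow> evaluation X x \<in> evaluation_span X"
  unfolding evaluation_span_def
  by (rule CollectI, rule exI [of _ "Suc 0"], rule exI [of _ "\<lambda>_. 1"], rule exI [of _ "\<lambda>_. x"])
    (simp add: fun_eq_iff)

lemma evaluation_span_scaleC:
  assumes "\<phi> \<in> evaluation_span X"
  shows "c *\<^sub>C \<phi> \<in> evaluation_span X"
proof -
  obtain m :: nat and a x where \<phi>: "\<phi> = (\<Sum>i<m. a i *\<^sub>C evaluation X (x i))" "\<forall>i<m. x i \<in> X"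
    using assms unfolding evaluation_span_def by blast
  have "c *\<^sub>C (\<Sum>i<k. a i *\<^sub>C evaluation X (x i)) = (\<Sum>i<k. (c * a i) *\<^sub>C evaluation X (x i))" for k
    by (induction k) (auto simp: fun_eq_iff algebra_simps)
  then have "c *\<^sub>C \<phi> = (\<Sum>i<m. (c * a i) *\<^sub>C evaluation X (x i))"
    unfolding \<phi>(1) .
  then show ?thesis
    using \<phi>(2) unfolding evaluation_span_def
    by (intro CollectI exI [of _ m] exI [of _ "\<lambda>i. c * a i"] exI [of _ x] conjI)
qed

lemma evaluation_span_add:
  assumes "\<phi> \<in> evaluation_span X" "\<psi> \<in> evaluation_span X"
  shows "\<phi> + \<psi> \<in> evaluation_span X"
proof -
  obtain m :: nat and a x where \<phi>: "\<phi> = (\<Sum>i<m. a i *\<^sub>C evaluation X (x i))" "\<forall>i<m. x i \<in> X"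
    using assms(1) unfolding evaluation_span_def by blast
  obtain k :: nat and b y where \<psi>: "\<psi> = (\<Sum>i<k. b i *\<^sub>C evaluation X (y i))" "\<forall>i<k. y i \<in> X"
    using assms(2) unfolding evaluation_span_def by blast
  define c where "c i = (if i < m then a i else b (i - m))" for i
  define z where "z i = (if i < m then x i else y (i - m))" for i
  have old: "(\<Sum>i<m. c i *\<^sub>C evaluation X (z i)) = \<phi>"
    unfolding \<phi>(1) by (rule sum.cong) (auto simp: c_def z_def)
  have new: "c (m + l) = b l" "z (m + l) = y l" for l
    by (simp_all add: c_def z_def)
  have "(\<Sum>i<m + l. c i *\<^sub>C evaluation X (z i)) = \<phi> + (\<Sum>i<l. b i *\<^sub>C evaluation X (y i))" for l
    by (induction l) (simp_all add: old new add.assoc del: scaleC_fun_apply)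
  then have "\<phi> + \<psi> = (\<Sum>i<m + k. c i *\<^sub>C evaluation X (z i))"
    unfolding \<psi>(1) by simp
  moreover have "\<forall>i<m + k. z i \<in> X"
    using \<phi>(2) \<psi>(2) by (simp add: z_def)
  ultimately show ?thesis
    unfolding evaluation_span_def by blast
qed

lemma evaluation_span_diff:
  assumes "\<phi> \<in> evaluation_span X" "\<psi> \<in> evaluation_span X"
  shows "\<phi> - \<psi> \<in> evaluation_span X"
proof -
  have "\<phi> - \<psi> = \<phi> + (- 1) *\<^sub>C \<psi>"
    by (simp add: fun_eq_iff)
  then show ?thesis
    using assms by (simp only: evaluation_span_add evaluation_span_scaleC)
qed

lemma lipschitz_functional_span:
  assumes "\<phi> \<in> evaluation_span X" "0 \<in> X"
  shows "lipschitz_functional X \<phi>"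
proof -
  have "lipschitz_functional X (\<Sum>i<m. a i *\<^sub>C evaluation X (x i))" if "\<forall>i<m. x i \<in> X" for m :: nat and a x
    using that
    by (induction m) (auto intro: lipschitz_functional_zero lipschitz_functional_add
        lipschitz_functional_scaleC lipschitz_functional_evaluation assms(2))
  then show ?thesis
    using assms(1) unfolding evaluation_span_def by blast
qed

lemma free_mnorm_zero: "free_mnorm n X 1 (\<lambda>_ _. 0) = 0"
proof -
  have "block_norm m 1 (\<lambda>i j p q. 0) \<le> 0" for m
    by (simp add: block_norm_le_iff block_bound_def L2_set_def)
  then show ?thesis
    unfolding free_mnorm_def dual_mnorm_def by (intro antisym SUP_least) (simp_all add: ennreal_neg)
qed

lemma evaluation_span_subset_free_space:
  assumes "0 < n" "0 \<in> X"
  shows "evaluation_span X \<subseteq> free_space n X"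
proof
  fix \<phi> assume \<phi>: "\<phi> \<in> evaluation_span X"
  have "free_mnorm n X 1 (\<lambda>_ _. \<phi> - \<phi>) = 0"
    using free_mnorm_zero by simp
  then have "\<exists>\<psi>\<in>evaluation_span X. free_mnorm n X 1 (\<lambda>_ _. \<phi> - \<psi>) < ennreal \<epsilon>" if "\<epsilon> > 0" for \<epsilon>
    using \<phi> that by (intro bexI [of _ \<phi>]) auto
  then show "\<phi> \<in> free_space n X"
    using lipschitz_functional_in_dual [OF lipschitz_functional_span [OF \<phi> assms(2)] assms]
    unfolding free_space_def by simp
qed

text \<open>A constant \<open>C\<close> in the definition of \<open>dual\<close> may be negative and then acts as 0, so the constants
  are made nonnegative before they are added.\<close>

lemma dual_add:
  assumes "\<phi> \<in> dual (Lip0 X) N" "\<psi> \<in> dual (Lip0 X) N"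
  shows "\<phi> + \<psi> \<in> dual (Lip0 X) N"
proof -
  obtain C where C: "\<And>f. f \<in> Lip0 X \<Longrightarrow> ennreal (cmod (\<phi> f)) \<le> ennreal C * N 1 (\<lambda>_ _. f)"
    using assms(1) unfolding dual_def by blast
  obtain D where D: "\<And>f. f \<in> Lip0 X \<Longrightarrow> ennreal (cmod (\<psi> f)) \<le> ennreal D * N 1 (\<lambda>_ _. f)"
    using assms(2) unfolding dual_def by blast
  have "ennreal (cmod ((\<phi> + \<psi>) f)) \<le> ennreal (max 0 C + max 0 D) * N 1 (\<lambda>_ _. f)"
    if f: "f \<in> Lip0 X" for f
  proof -
    have "ennreal (cmod ((\<phi> + \<psi>) f)) \<le> ennreal (cmod (\<phi> f)) + ennreal (cmod (\<psi> f))"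
      by (simp add: norm_triangle_ineq ennreal_leI flip: ennreal_plus)
    also have "\<dots> \<le> ennreal C * N 1 (\<lambda>_ _. f) + ennreal D * N 1 (\<lambda>_ _. f)"
      by (intro add_mono C D f)
    also have "\<dots> \<le> ennreal (max 0 C) * N 1 (\<lambda>_ _. f) + ennreal (max 0 D) * N 1 (\<lambda>_ _. f)"
      by (intro add_mono mult_right_mono ennreal_leI) auto
    finally show ?thesis
      by (simp add: distrib_right)
  qed
  then have "\<exists>E. \<forall>f\<in>Lip0 X. ennreal (cmod ((\<phi> + \<psi>) f)) \<le> ennreal E * N 1 (\<lambda>_ _. f)"
    by blast
  then show ?thesis
    using assms unfolding dual_def clinear_on_def by (auto simp: scaleC_complex_def algebra_simps)
qed

lemma dual_scaleC:
  assumes "\<phi> \<in> dual (Lip0 X) N"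
  shows "c *\<^sub>C \<phi> \<in> dual (Lip0 X) N"
proof -
  obtain C where C: "\<And>f. f \<in> Lip0 X \<Longrightarrow> ennreal (cmod (\<phi> f)) \<le> ennreal C * N 1 (\<lambda>_ _. f)"
    using assms(1) unfolding dual_def by blast
  have "ennreal (cmod ((c *\<^sub>C \<phi>) f)) \<le> ennreal (cmod c * C) * N 1 (\<lambda>_ _. f)"
    if f: "f \<in> Lip0 X" for f
    using mult_left_mono [OF C [OF f], of "ennreal (cmod c)"]
    by (simp add: norm_mult ennreal_mult' mult.assoc)
  then have "\<exists>E. \<forall>f\<in>Lip0 X. ennreal (cmod ((c *\<^sub>C \<phi>) f)) \<le> ennreal E * N 1 (\<lambda>_ _. f)"
    by blast
  then show ?thesis
    using assms unfolding dual_def clinear_on_def by (auto simp: scaleC_complex_def algebra_simps)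
qed

lemma free_space_add:
  assumes "\<phi> \<in> free_space n X" "\<psi> \<in> free_space n X"
  shows "\<phi> + \<psi> \<in> free_space n X"
proof -
  have "\<exists>\<rho>\<in>evaluation_span X. free_mnorm n X 1 (\<lambda>_ _. (\<phi> + \<psi>) - \<rho>) < ennreal \<epsilon>" if \<epsilon>: "\<epsilon> > 0" for \<epsilon>
  proof -
    have "\<epsilon> / 2 > 0"
      using \<epsilon> by simp
    then obtain a b where a: "a \<in> evaluation_span X" "free_mnorm n X 1 (\<lambda>_ _. \<phi> - a) < ennreal (\<epsilon> / 2)"
      and b: "b \<in> evaluation_span X" "free_mnorm n X 1 (\<lambda>_ _. \<psi> - b) < ennreal (\<epsilon> / 2)"
      using assms unfolding free_space_def by blast
    have "(\<phi> + \<psi>) - (a + b) = (\<phi> - a) + (\<psi> - b)"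
      by (simp add: fun_eq_iff)
    then have "free_mnorm n X 1 (\<lambda>_ _. (\<phi> + \<psi>) - (a + b)) \<le>
        free_mnorm n X 1 (\<lambda>_ _. \<phi> - a) + free_mnorm n X 1 (\<lambda>_ _. \<psi> - b)"
      using free_mnorm_add [of n X "\<phi> - a" "\<psi> - b"] by (simp only:)
    also have "\<dots> < ennreal (\<epsilon> / 2) + ennreal (\<epsilon> / 2)"
      using a(2) b(2) by (rule add_strict_mono)
    also have "\<dots> = ennreal \<epsilon>"
      using \<epsilon> by (simp flip: ennreal_plus)
    finally show ?thesis
      using evaluation_span_add [OF a(1) b(1)] by blast
  qed
  then show ?thesis
    using assms dual_add unfolding free_space_def by blast
qed

lemma free_space_scaleC:
  assumes "\<phi> \<in> free_space n X"
  shows "c *\<^sub>C \<phi> \<in> free_space n X"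
proof -
  have "\<exists>\<rho>\<in>evaluation_span X. free_mnorm n X 1 (\<lambda>_ _. c *\<^sub>C \<phi> - \<rho>) < ennreal \<epsilon>" if \<epsilon>: "\<epsilon> > 0" for \<epsilon>
  proof -
    obtain \<delta> where "\<delta> > 0" "\<delta> * cmod c < \<epsilon>"
      using scaled_below [OF \<epsilon> norm_ge_zero] by blast
    then obtain a where a: "a \<in> evaluation_span X" "free_mnorm n X 1 (\<lambda>_ _. \<phi> - a) < ennreal \<delta>"
      using assms unfolding free_space_def by blast
    have "c *\<^sub>C \<phi> - c *\<^sub>C a = c *\<^sub>C (\<phi> - a)"
      by (simp add: fun_eq_iff algebra_simps)
    then have "free_mnorm n X 1 (\<lambda>_ _. c *\<^sub>C \<phi> - c *\<^sub>C a) \<le> ennreal (cmod c) * free_mnorm n X 1 (\<lambda>_ _. \<phi> - a)"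
      using free_mnorm_scaleC [of n X c "\<phi> - a"] by (simp only:)
    also have "\<dots> \<le> ennreal (cmod c) * ennreal \<delta>"
      using a(2) by (intro mult_left_mono) auto
    also have "\<dots> = ennreal (cmod c * \<delta>)"
      using \<open>\<delta> > 0\<close> by (simp add: ennreal_mult)
    also have "\<dots> < ennreal \<epsilon>"
      using \<open>\<delta> > 0\<close> \<open>\<delta> * cmod c < \<epsilon>\<close> by (simp add: ennreal_less_iff mult.commute)
    finally show ?thesis
      using evaluation_span_scaleC [OF a(1)] by blast
  qed
  then show ?thesis
    using assms dual_scaleC unfolding free_space_def by blast
qed

section \<open>The barycentre map\<close>

lemma cinner_add_right: "cinner x (y + z) = cinner x y + cinner x (z::'h::complex_hilbert)"
  by (metis cinner_add_left cinner_commute complex_cnj_add)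

lemma cinner_scaleC_right: "cinner x (c *\<^sub>C y) = cnj c * cinner x (y::'h::complex_hilbert)"
  by (metis cinner_commute cinner_scaleC_left complex_cnj_mult)

lemma cinner_Cauchy_Schwarz: "cmod (cinner x y) \<le> norm x * norm (y::'h::complex_hilbert)"
proof (cases "norm y = 0")
  case True
  have "0 *\<^sub>C y = 0"
    using norm_scaleC [of 0 y] by simp
  moreover have "y = 0"
    using True by simp
  ultimately have "cinner x y = cnj 0 * cinner x y"
    by (metis cinner_scaleC_right)
  then show ?thesis
    by simp
next
  case False
  define N where "N = complex_of_real ((norm y)\<^sup>2)"
  define c where "c = - cinner x y / N"
  have N: "N \<noteq> 0" "cnj N = N"
    using False by (auto simp: N_def)
  have yx: "cinner y x = cnj (cinner x y)"
    by (rule cinner_commute)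
  have "complex_of_real ((norm (x + c *\<^sub>C y))\<^sup>2) = cinner (x + c *\<^sub>C y) (x + c *\<^sub>C y)"
    by (rule cinner_self [symmetric])
  also have "\<dots> = complex_of_real ((norm x)\<^sup>2) + cnj c * cinner x y + c * cinner y x + c * cnj c * N"
    by (simp add: cinner_add_left cinner_add_right cinner_scaleC_left cinner_scaleC_right
        cinner_self [of x] cinner_self [of y] N_def algebra_simps)
  also have "\<dots> = complex_of_real ((norm x)\<^sup>2) - cinner x y * cnj (cinner x y) / N"
    using N by (simp add: c_def yx field_simps power2_eq_square)
  also have "\<dots> = complex_of_real ((norm x)\<^sup>2 - (cmod (cinner x y))\<^sup>2 / (norm y)\<^sup>2)"
    by (simp add: N_def flip: complex_norm_square)
  finally have "(norm (x + c *\<^sub>C y))\<^sup>2 = (norm x)\<^sup>2 - (cmod (cinner x y))\<^sup>2 / (norm y)\<^sup>2"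
    by (simp only: of_real_eq_iff)
  then have "(cmod (cinner x y))\<^sup>2 / (norm y)\<^sup>2 \<le> (norm x)\<^sup>2"
    using zero_le_power2 [of "norm (x + c *\<^sub>C y)"] by linarith
  then have "(cmod (cinner x y))\<^sup>2 \<le> (norm x * norm y)\<^sup>2"
    using False by (simp add: pos_divide_le_eq power_mult_distrib)
  then show ?thesis
    by (rule power2_le_imp_le) simp
qed

definition coefficient ::
  "('h::complex_hilbert \<Rightarrow>\<^sub>L 'h) set \<Rightarrow> 'h \<Rightarrow> 'h \<Rightarrow> ('h \<Rightarrow>\<^sub>L 'h) \<Rightarrow> complex" where
  "coefficient X h k = (\<lambda>A. if A \<in> X then cinner (A h) k else 0)"

lemma cinner_diff_left: "cinner (x - y) z = cinner x z - cinner (y::'h::complex_hilbert) z"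
  by (metis add_diff_cancel cinner_add_left diff_add_cancel)

lemma cinner_sum_left: "cinner (\<Sum>i\<in>I. f i) z = (\<Sum>i\<in>I. cinner (f i) (z::'h::complex_hilbert))"
proof (induction I rule: infinite_finite_induct)
  have "cinner 0 z = 0"
    using cinner_Cauchy_Schwarz [of 0 z] by simp
  then show "cinner (\<Sum>i\<in>I. f i) z = (\<Sum>i\<in>I. cinner (f i) z)" if "infinite I" for I
    using that by simp
  show "cinner (\<Sum>i\<in>{}. f i) z = (\<Sum>i\<in>{}. cinner (f i) z)"
    using \<open>cinner 0 z = 0\<close> by simp
qed (simp add: cinner_add_left)

lemma coefficient_bound: "cmod (cinner (blinfun_apply A h) k) \<le> norm A * norm h * norm k"
  using cinner_Cauchy_Schwarz [of "A h" k] mult_right_mono [OF norm_blinfun [of A h], of "norm k"]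
  by simp

lemma coefficient_in_Lip0:
  assumes "0 \<in> X"
  shows "coefficient X h k \<in> Lip0 X"
proof -
  have "(norm h * norm k)-lipschitz_on X (coefficient X h k)"
  proof (rule lipschitz_onI)
    fix A B assume "A \<in> X" "B \<in> X"
    then show "dist (coefficient X h k A) (coefficient X h k B) \<le> norm h * norm k * dist A B"
      using coefficient_bound [of "A - B" h k]
      by (simp add: coefficient_def dist_norm minus_blinfun.rep_eq cinner_diff_left mult_ac)
  qed simp
  moreover have "coefficient X h k 0 = 0"
    using coefficient_bound [of 0 h k] by (simp add: coefficient_def)
  ultimately show ?thesis
    by (auto simp: Lip0_def coefficient_def)
qed

text \<open>Applied to a matrix, the coefficient function compresses the operator on the \<open>\<ell>\<^sub>2\<close>-sum by
  \<open>\<xi> \<mapsto> [\<xi>\<^sub>j h]\<close> and by pairing with \<open>k\<close> in each component, both of norm at most 1. Moving the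
  scalar \<open>\<xi>\<^sub>j\<close> inside uses that the elements of \<open>X\<close> are complex-linear.\<close>

lemma coefficient_n_lipschitz:
  assumes "operator_space X" "norm h \<le> 1" "norm k \<le> 1"
  shows "n_lipschitz 1 n X 1 (\<lambda>_ _. coefficient X h k)"
  unfolding n_lipschitz_def block_bound_def
proof (intro ballI allI)
  fix x y :: "nat \<Rightarrow> nat \<Rightarrow> 'a \<Rightarrow>\<^sub>L 'a" and \<xi> :: "nat \<times> nat \<Rightarrow> complex"
  assume xy: "x \<in> mats n X" "y \<in> mats n X"
  let ?d = "\<lambda>i j. x i j - y i j"
  have entry: "(coefficient X h k (x i j) - coefficient X h k (y i j)) * c = cinner (?d i j (c *\<^sub>C h)) k"
    if "i < n" "j < n" for i j c
  proof -
    have "x i j \<in> X" "y i j \<in> X"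
      using that xy by (auto simp: mats_def)
    moreover from this have "x i j (c *\<^sub>C h) = c *\<^sub>C x i j h" "y i j (c *\<^sub>C h) = c *\<^sub>C y i j h"
      using assms(1) unfolding operator_space_def clinear_on_def by auto
    ultimately show ?thesis
      by (simp add: coefficient_def minus_blinfun.rep_eq cinner_diff_left cinner_scaleC_left algebra_simps)
  qed
  have "cmod (\<Sum>j<n. (coefficient X h k (x i j) - coefficient X h k (y i j)) * \<xi> (j, 0))
      \<le> norm (\<Sum>j<n. ?d i j (\<xi> (j, 0) *\<^sub>C h))" if "i < n" for i
  proof -
    have "(\<Sum>j<n. (coefficient X h k (x i j) - coefficient X h k (y i j)) * \<xi> (j, 0)) =
        cinner (\<Sum>j<n. ?d i j (\<xi> (j, 0) *\<^sub>C h)) k"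
      unfolding cinner_sum_left using that by (intro sum.cong) (auto simp: entry)
    then show ?thesis
      using cinner_Cauchy_Schwarz [of "\<Sum>j<n. ?d i j (\<xi> (j, 0) *\<^sub>C h)" k]
        mult_left_mono [OF assms(3), of "norm (\<Sum>j<n. ?d i j (\<xi> (j, 0) *\<^sub>C h))"]
      by simp
  qed
  then have "L2_set (\<lambda>i. cmod (\<Sum>j<n. (coefficient X h k (x i j) - coefficient X h k (y i j)) * \<xi> (j, 0))) {..<n}
      \<le> L2_set (\<lambda>i. norm (\<Sum>j<n. ?d i j (\<xi> (j, 0) *\<^sub>C h))) {..<n}"
    by (intro L2_set_mono) auto
  also have "\<dots> \<le> op_norm n ?d * L2_set (\<lambda>j. norm (\<xi> (j, 0) *\<^sub>C h)) {..<n}"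
    by (rule L2_norm_apply_le)
  also have "\<dots> \<le> op_norm n ?d * L2_set (\<lambda>j. cmod (\<xi> (j, 0))) {..<n}"
    using assms(2)
    by (intro mult_left_mono L2_set_mono) (auto simp: norm_scaleC mult_left_le op_norm_nonneg)
  finally show "L2_set (\<lambda>s. cmod (\<Sum>t\<in>{..<n} \<times> {..<1::nat}. (coefficient X h k (x (fst s) (fst t)) -
        coefficient X h k (y (fst s) (fst t))) * \<xi> t)) ({..<n} \<times> {..<1::nat})
      \<le> 1 * op_norm n ?d * L2_set (\<lambda>t. cmod (\<xi> t)) ({..<n} \<times> {..<1::nat})"
    unfolding One_nat_def sum_times_singleton L2_set_times_singleton by simp
qed

text \<open>For the normalized vectors \<open>u = h/\<parallel>h\<parallel>\<close> and \<open>k = A h/\<parallel>A h\<parallel>\<close> the coefficient is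
  \<open>\<parallel>A h\<parallel>/\<parallel>h\<parallel>\<close>.\<close>

lemma norm_le_coefficients:
  fixes A :: "'h::complex_hilbert \<Rightarrow>\<^sub>L 'h"
  assumes "0 \<le> M" "\<And>h k. norm h \<le> 1 \<Longrightarrow> norm k \<le> 1 \<Longrightarrow> cmod (cinner (A h) k) \<le> M"
  shows "norm A \<le> M"
proof (rule norm_blinfun_bound [OF assms(1)])
  fix h
  show "norm (A h) \<le> M * norm h"
  proof (cases "A h = 0")
    case False
    then have h: "norm h > 0"
      by (metis zero_less_norm_iff blinfun.zero_right)
    define u where "u = (1 / norm h) *\<^sub>R h"
    define k where "k = (1 / norm (A h)) *\<^sub>R A h"
    have "cinner (A u) k = of_real (1 / norm h) * (of_real (1 / norm (A h)) * of_real ((norm (A h))\<^sup>2))"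
      unfolding u_def k_def blinfun.scaleR_right
      by (simp only: scaleR_scaleC cinner_scaleC_left
          cinner_scaleC_right cinner_self complex_cnj_complex_of_real mult_ac)
    also have "\<dots> = complex_of_real (norm (A h) / norm h)"
      using False by (simp add: power2_eq_square)
    finally have "cmod (cinner (A u) k) = norm (A h) / norm h"
      by (simp only: norm_of_real) simp
    moreover have "norm u \<le> 1" "norm k \<le> 1"
      using h False by (auto simp: u_def k_def)
    ultimately show ?thesis
      using assms(2) [of u k] h by (simp add: pos_divide_le_eq)
  qed (use assms(1) in simp)
qed

text \<open>A description of \<open>\<beta> \<phi> = y\<close> by values of \<open>\<phi>\<close>, linear in \<open>(\<phi>, y)\<close> by inspection.\<close>

definition barycentre ::
  "('h::complex_hilbert \<Rightarrow>\<^sub>L 'h) set \<Rightarrow> ((('h \<Rightarrow>\<^sub>L 'h) \<Rightarrow> complex) \<Rightarrow> complex) \<Rightarrow> ('h \<Rightarrow>\<^sub>L 'h) \<Rightarrow> bool" where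
  "barycentre X \<phi> y \<longleftrightarrow> y \<in> X \<and>
     (\<forall>h k. norm h \<le> 1 \<longrightarrow> norm k \<le> 1 \<longrightarrow> cinner (y h) k = \<phi> (coefficient X h k))"

lemma barycentre_unique:
  assumes "barycentre X \<phi> y" "barycentre X \<phi> z"
  shows "y = z"
proof -
  have "norm (y - z) \<le> 0"
    by (rule norm_le_coefficients)
      (use assms in \<open>auto simp: barycentre_def minus_blinfun.rep_eq cinner_diff_left\<close>)
  then show ?thesis
    by simp
qed

lemma norm_coefficient_le_free_mnorm:
  assumes "operator_space X" "norm h \<le> 1" "norm k \<le> 1"
  shows "ennreal (cmod (\<phi> (coefficient X h k))) \<le> free_mnorm n X 1 (\<lambda>_ _. \<phi>)"
  using assms
  by (intro norm_le_free_mnorm coefficient_in_Lip0 coefficient_n_lipschitz)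
    (auto simp: operator_space_def)

lemma norm_barycentre_le:
  assumes "operator_space X" "barycentre X \<phi> y"
  shows "ennreal (norm y) \<le> free_mnorm n X 1 (\<lambda>_ _. \<phi>)"
proof (cases "free_mnorm n X 1 (\<lambda>_ _. \<phi>)")
  case (real r)
  have "norm y \<le> r"
  proof (rule norm_le_coefficients [OF real(1)])
    fix h k :: 'a assume "norm h \<le> 1" "norm k \<le> 1"
    then show "cmod (cinner (y h) k) \<le> r"
      using norm_coefficient_le_free_mnorm [OF assms(1), of h k \<phi> n] real assms(2)
      by (simp add: barycentre_def)
  qed
  then show ?thesis
    unfolding real(2) by (rule ennreal_leI)
qed simp

lemma barycentre_add:
  assumes "operator_space X" "barycentre X \<phi> y" "barycentre X \<psi> z"
  shows "barycentre X (\<phi> + \<psi>) (y + z)"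
  using assms unfolding barycentre_def operator_space_def
  by (simp add: plus_blinfun.rep_eq cinner_add_left)

lemma barycentre_scaleC:
  assumes "operator_space X" "barycentre X \<phi> y"
  shows "barycentre X (c *\<^sub>C \<phi>) (c *\<^sub>C y)"
  using assms unfolding barycentre_def operator_space_def
  by (simp add: scaleC_blinfun.rep_eq cinner_scaleC_left)

lemma barycentre_zero:
  assumes "operator_space X"
  shows "barycentre X 0 0"
  unfolding barycentre_def
  using assms coefficient_bound [of 0] by (auto simp: operator_space_def)

lemma barycentre_sum:
  assumes "operator_space X" "\<forall>i<m. x i \<in> X"
  shows "barycentre X (\<Sum>i<(m::nat). a i *\<^sub>C evaluation X (x i)) (\<Sum>i<m. a i *\<^sub>C x i)"
proof -
  have "barycentre X (evaluation X z) z" if "z \<in> X" for z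
  proof -
    have "0 \<in> X"
      using assms(1) by (simp add: operator_space_def)
    then show ?thesis
      using that coefficient_in_Lip0 [of X]
      by (auto simp: barycentre_def evaluation_def) (auto simp: coefficient_def)
  qed
  then show ?thesis
    using assms(2)
  proof (induction m)
    case 0
    then show ?case
      using barycentre_zero [OF assms(1)] by (simp only: lessThan_0 sum.empty)
  next
    case (Suc m)
    then have "barycentre X ((\<Sum>i<m. a i *\<^sub>C evaluation X (x i)) + a m *\<^sub>C evaluation X (x m))
        ((\<Sum>i<m. a i *\<^sub>C x i) + a m *\<^sub>C x m)"
      by (intro barycentre_add barycentre_scaleC assms(1) Suc.IH Suc.prems(1)) auto
    then show ?case
      by (simp only: sum.lessThan_Suc)
  qed
qed

lemma free_space_approximation:
  assumes "\<phi> \<in> free_space n X" "0 < \<epsilon>"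
  obtains m :: nat and a x where "\<forall>i<m. x i \<in> X"
    "free_mnorm n X 1 (\<lambda>_ _. \<phi> - (\<Sum>i<m. a i *\<^sub>C evaluation X (x i))) < ennreal \<epsilon>"
  using assms unfolding free_space_def evaluation_span_def by blast

lemma coefficient_approximation:
  assumes "operator_space X" "norm h \<le> 1" "norm k \<le> 1" "barycentre X \<psi> y"
    "free_mnorm n X 1 (\<lambda>_ _. \<phi> - \<psi>) < ennreal \<epsilon>"
  shows "cmod (\<phi> (coefficient X h k) - cinner (y h) k) < \<epsilon>"
proof -
  have "ennreal (cmod ((\<phi> - \<psi>) (coefficient X h k))) < ennreal \<epsilon>"
    using norm_coefficient_le_free_mnorm [OF assms(1-3)] assms(5) by (rule order_le_less_trans)
  then show ?thesis
    using assms(2-4) by (simp add: barycentre_def ennreal_less_iff)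
qed

text \<open>The barycentres of elements of the span that converge to \<open>\<phi>\<close> form a Cauchy sequence, because
  their coefficients are close to those prescribed by \<open>\<phi>\<close>, uniformly over the unit balls. The limit
  lies in the closed set \<open>X\<close>.\<close>

lemma barycentre_exists:
  assumes "operator_space X" "\<phi> \<in> free_space n X"
  shows "\<exists>y. barycentre X \<phi> y"
proof -
  define r where "r i = inverse (real (Suc i))" for i
  have r: "r i > 0" "r \<longlonglongrightarrow> 0" for i
    unfolding r_def by (simp, rule LIMSEQ_inverse_real_of_nat)
  have "\<exists>\<psi> y. barycentre X \<psi> y \<and> free_mnorm n X 1 (\<lambda>_ _. \<phi> - \<psi>) < ennreal (r i)" for i
  proof -
    obtain m :: nat and a x where "\<forall>i<m. x i \<in> X"
      "free_mnorm n X 1 (\<lambda>_ _. \<phi> - (\<Sum>i<m. a i *\<^sub>C evaluation X (x i))) < ennreal (r i)"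
      by (rule free_space_approximation [OF assms(2) r(1)])
    then show ?thesis
      using barycentre_sum [OF assms(1)] by blast
  qed
  then obtain \<psi> y where y: "\<And>i. barycentre X (\<psi> i) (y i)"
    "\<And>i. free_mnorm n X 1 (\<lambda>_ _. \<phi> - \<psi> i) < ennreal (r i)"
    by metis
  have close: "cmod (\<phi> (coefficient X h k) - cinner (y i h) k) < r i"
    if "norm h \<le> 1" "norm k \<le> 1" for h k i
    by (rule coefficient_approximation [OF assms(1) that y])
  have dist: "norm (y i - y j) \<le> r i + r j" for i j
  proof (rule norm_le_coefficients)
    fix h k :: 'a assume hk: "norm h \<le> 1" "norm k \<le> 1"
    have "cinner ((y i - y j) h) k = (\<phi> (coefficient X h k) - cinner (y j h) k)
        - (\<phi> (coefficient X h k) - cinner (y i h) k)"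
      by (simp add: minus_blinfun.rep_eq cinner_diff_left)
    then show "cmod (cinner ((y i - y j) h) k) \<le> r i + r j"
      using norm_triangle_ineq4 [of "\<phi> (coefficient X h k) - cinner (y j h) k"
          "\<phi> (coefficient X h k) - cinner (y i h) k"] close [OF hk, of i] close [OF hk, of j]
      by simp
  qed (use r(1) [of i] r(1) [of j] in linarith)
  have "Cauchy y"
  proof (rule CauchyI)
    fix e :: real assume "e > 0"
    then have "\<forall>\<^sub>F i in sequentially. r i < e / 2"
      using r(2) by (intro order_tendstoD) auto
    then obtain N where N: "\<And>i. i \<ge> N \<Longrightarrow> r i < e / 2"
      unfolding eventually_sequentially by blast
    have "norm (y i - y j) < e" if "i \<ge> N" "j \<ge> N" for i j
      using dist [of i j] N [OF that(1)] N [OF that(2)] by linarith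
    then show "\<exists>M. \<forall>m\<ge>M. \<forall>n\<ge>M. norm (y m - y n) < e"
      by blast
  qed
  then obtain z where z: "y \<longlonglongrightarrow> z"
    using Cauchy_convergent convergent_def by blast
  have "z \<in> X"
    using assms(1) y(1) by (intro closed_sequentially [OF _ _ z])
      (auto simp: operator_space_def barycentre_def)
  moreover have "cinner (z h) k = \<phi> (coefficient X h k)" if hk: "norm h \<le> 1" "norm k \<le> 1" for h k
  proof -
    have "cmod (cinner (z h) k - \<phi> (coefficient X h k)) \<le> norm (y i - z) * norm h * norm k + r i" for i
    proof -
      have split: "cinner (z h) k - \<phi> (coefficient X h k) =
          - cinner ((y i - z) h) k - (\<phi> (coefficient X h k) - cinner (y i h) k)"
        by (simp add: minus_blinfun.rep_eq cinner_diff_left)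
      have "cmod (cinner (z h) k - \<phi> (coefficient X h k)) \<le>
          cmod (- cinner ((y i - z) h) k) + cmod (\<phi> (coefficient X h k) - cinner (y i h) k)"
        unfolding split by (rule norm_triangle_ineq4)
      then show ?thesis
        using close [OF hk, of i] coefficient_bound [of "y i - z" h k]
        unfolding norm_minus_cancel by linarith
    qed
    moreover have "(\<lambda>i. norm (y i - z) * norm h * norm k + r i) \<longlonglongrightarrow> norm (z - z) * norm h * norm k + 0"
      by (intro tendsto_intros z r(2))
    ultimately have "cmod (cinner (z h) k - \<phi> (coefficient X h k)) \<le> norm (z - z) * norm h * norm k + 0"
      by (intro LIMSEQ_le_const) auto
    then show ?thesis
      by simp
  qed
  ultimately show ?thesis
    unfolding barycentre_def by blast
qed

text \<open>Taking barycentres is a bounded linear map with the values on the span that characterize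
  \<open>\<beta>\<close>. Two such maps agree on the dense span, hence everywhere, so the definite description in
  \<open>beta\<close> denotes this map.\<close>

lemma barycentre_beta:
  assumes os: "operator_space X" and "0 < n" and "\<phi> \<in> free_space n X"
  shows "barycentre X \<phi> (beta n X \<phi>)"
proof -
  define is_beta where "is_beta B \<longleftrightarrow>
     B ` free_space n X \<subseteq> X \<and>
     (\<forall>\<phi>. \<phi> \<notin> free_space n X \<longrightarrow> B \<phi> = 0) \<and>
     clinear_on (free_space n X) B \<and>
     (\<exists>C. \<forall>\<phi>\<in>free_space n X. ennreal (norm (B \<phi>)) \<le> ennreal C * free_mnorm n X 1 (\<lambda>_ _. \<phi>)) \<and>
     (\<forall>(m::nat) a x. (\<forall>i<m. x i \<in> X) \<longrightarrow>
        B (\<Sum>i<m. a i *\<^sub>C evaluation X (x i)) = (\<Sum>i<m. a i *\<^sub>C x i))" for B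
  have "0 \<in> X"
    using os by (simp add: operator_space_def)
  have span: "(\<Sum>i<(m::nat). a i *\<^sub>C evaluation X (x i)) \<in> free_space n X" if "\<forall>i<m. x i \<in> X" for m a x
    using that evaluation_span_subset_free_space [OF assms(2) \<open>0 \<in> X\<close>]
    unfolding evaluation_span_def by blast
  define B where "B \<phi> = (if \<phi> \<in> free_space n X then THE y. barycentre X \<phi> y else 0)" for \<phi>
  have B: "barycentre X \<phi> (B \<phi>)" if "\<phi> \<in> free_space n X" for \<phi>
    using theI' [of "barycentre X \<phi>"] barycentre_exists [OF os that] barycentre_unique that
    unfolding B_def by auto
  have B_eq: "B \<phi> = y" if "\<phi> \<in> free_space n X" "barycentre X \<phi> y" for \<phi> y
    using barycentre_unique B that by blast
  have "is_beta B"
    unfolding is_beta_def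
  proof (intro conjI allI impI)
    show "B ` free_space n X \<subseteq> X"
      using B by (auto simp: barycentre_def)
    show "B \<phi> = 0" if "\<phi> \<notin> free_space n X" for \<phi>
      using that by (simp add: B_def)
    show "clinear_on (free_space n X) B"
      unfolding clinear_on_def
      by (intro conjI allI ballI B_eq free_space_add free_space_scaleC barycentre_add [OF os]
          barycentre_scaleC [OF os] B)
    show "\<exists>C. \<forall>\<phi>\<in>free_space n X. ennreal (norm (B \<phi>)) \<le> ennreal C * free_mnorm n X 1 (\<lambda>_ _. \<phi>)"
      using norm_barycentre_le [OF os B] by (intro exI [of _ 1]) simp
    show "B (\<Sum>i<(m::nat). a i *\<^sub>C evaluation X (x i)) = (\<Sum>i<m. a i *\<^sub>C x i)"
      if "\<forall>i<m. x i \<in> X" for m a x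
      by (rule B_eq [OF span [OF that] barycentre_sum [OF os that]])
  qed
  moreover have "B' \<phi> = B \<phi>" if B': "is_beta B'" and \<phi>: "\<phi> \<in> free_space n X" for B' \<phi>
  proof -
    obtain C where C: "\<And>\<phi>. \<phi> \<in> free_space n X \<Longrightarrow>
        ennreal (norm (B' \<phi>)) \<le> ennreal C * free_mnorm n X 1 (\<lambda>_ _. \<phi>)"
      using B' unfolding is_beta_def by blast
    (* B' contributes max 0 C to the error at \<phi> - \<psi>, and B contributes 1. *)
    define D where "D = max 0 C + 1"
    have "norm (B' \<phi> - B \<phi>) \<le> 0"
    proof (rule field_le_epsilon)
      fix e :: real assume "e > 0"
      then obtain \<epsilon> where \<epsilon>: "\<epsilon> > 0" "\<epsilon> * D < e"
        using scaled_below [of e D] by (auto simp: D_def)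
      obtain m :: nat and a x where x: "\<forall>i<m. x i \<in> X" and
        close: "free_mnorm n X 1 (\<lambda>_ _. \<phi> - (\<Sum>i<m. a i *\<^sub>C evaluation X (x i))) < ennreal \<epsilon>"
        by (rule free_space_approximation [OF \<phi> \<epsilon>(1)])
      define \<psi> where "\<psi> = (\<Sum>i<m. a i *\<^sub>C evaluation X (x i))"
      have \<psi>: "\<psi> \<in> free_space n X"
        unfolding \<psi>_def by (rule span [OF x])
      have "\<phi> - \<psi> = \<phi> + (- 1) *\<^sub>C \<psi>"
        by (simp add: fun_eq_iff)
      then have diff: "\<phi> - \<psi> \<in> free_space n X"
        using free_space_add [OF \<phi> free_space_scaleC [OF \<psi>, of "- 1"]] by (simp only:)
      have split: "G \<phi> = G \<psi> + G (\<phi> - \<psi>)" if "is_beta G" for G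
      proof -
        have "G (\<psi> + (\<phi> - \<psi>)) = G \<psi> + G (\<phi> - \<psi>)"
          using that \<psi> diff unfolding is_beta_def clinear_on_def by blast
        then show ?thesis
          by simp
      qed
      have "B' \<psi> = B \<psi>"
        using B' \<open>is_beta B\<close> x unfolding is_beta_def \<psi>_def by simp
      then have "B' \<phi> - B \<phi> = B' (\<phi> - \<psi>) - B (\<phi> - \<psi>)"
        using split [OF B'] split [OF \<open>is_beta B\<close>] by simp
      moreover have "norm (B (\<phi> - \<psi>)) \<le> \<epsilon>"
      proof -
        have "ennreal (norm (B (\<phi> - \<psi>))) < ennreal \<epsilon>"
          using norm_barycentre_le [OF os B [OF diff]] close unfolding \<psi>_def by (rule order_le_less_trans)
        then show ?thesis
          by (simp add: ennreal_less_iff)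
      qed
      moreover have "norm (B' (\<phi> - \<psi>)) \<le> max 0 C * \<epsilon>"
      proof -
        have "ennreal (norm (B' (\<phi> - \<psi>))) \<le> ennreal C * free_mnorm n X 1 (\<lambda>_ _. \<phi> - \<psi>)"
          by (rule C [OF diff])
        also have "\<dots> \<le> ennreal (max 0 C) * ennreal \<epsilon>"
          using close unfolding \<psi>_def by (intro mult_mono ennreal_leI) auto
        also have "\<dots> = ennreal (max 0 C * \<epsilon>)"
          using \<epsilon>(1) by (simp add: ennreal_mult)
        finally show ?thesis
          using \<epsilon>(1) by (simp add: ennreal_le_iff)
      qed
      ultimately have "norm (B' \<phi> - B \<phi>) \<le> max 0 C * \<epsilon> + \<epsilon>"
        using norm_triangle_ineq4 [of "B' (\<phi> - \<psi>)" "B (\<phi> - \<psi>)"] by simp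
      then show "norm (B' \<phi> - B \<phi>) \<le> 0 + e"
        using \<epsilon>(2) by (simp add: D_def algebra_simps)
    qed
    then show ?thesis
      by simp
  qed
  then have "B' = B" if "is_beta B'" for B'
  proof (intro ext)
    fix \<phi>
    show "B' \<phi> = B \<phi>"
    proof (cases "\<phi> \<in> free_space n X")
      case False
      then show ?thesis
        using that unfolding is_beta_def B_def by simp
    qed (use \<open>\<And>B' \<phi>. is_beta B' \<Longrightarrow> \<phi> \<in> free_space n X \<Longrightarrow> B' \<phi> = B \<phi>\<close> that in blast)
  qed
  ultimately have "(THE B. is_beta B) = B"
    by (rule the_equality)
  then have "beta n X = B"
    unfolding beta_def is_beta_def .
  then show ?thesis
    using B [OF assms(3)] by simp
qed

section \<open>The lifting\<close>

lemma subspace_operator_space: "operator_space X \<Longrightarrow> subspace X"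
  unfolding operator_space_def subspace_def by (auto simp: scaleR_blinfun_scaleC)

locale operator_space_cube = dyadic_cube X x
  for X :: "('h::complex_hilbert \<Rightarrow>\<^sub>L 'h) set" and x +
  assumes operator_space_X: "operator_space X"
begin

lemma scaleC_in: "A \<in> X \<Longrightarrow> c *\<^sub>C A \<in> X"
  using operator_space_X by (simp add: operator_space_def)

text \<open>The quotient compares the amplified average at the matrices \<open>[y\<^sub>i\<^sub>j/2\<^sup>N]\<close> and \<open>0\<close>, and the factors
  \<open>2\<^sup>N\<close> and \<open>2\<^sup>-\<^sup>N\<close> cancel.\<close>

lemma block_bound_quotient:
  assumes "n_lipschitz 1 n X m f" "y \<in> mats n X"
  shows "block_bound n m (\<lambda>i j p q. quotient N 0 (y i j) (f p q)) (op_norm n y)"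
proof -
  let ?s = "\<lambda>i j. 0 + (1/2) ^ N *\<^sub>R y i j"
  have "n_lipschitz 1 n X m (\<lambda>p q. avg N (f p q))"
    by (rule n_lipschitz_cube_avg) (auto simp: subspace_X edge_in assms(1))
  moreover have "?s \<in> mats n X" "(\<lambda>_ _. 0) \<in> mats n X"
    using assms(2) zero_in scale_in by (auto simp: mats_def)
  ultimately have "block_bound n m (\<lambda>i j p q. avg N (f p q) (?s i j) - avg N (f p q) 0)
      (op_norm n (\<lambda>i j. ?s i j - 0))"
    unfolding n_lipschitz_def by fastforce
  then have "block_bound n m (\<lambda>i j p q. 2 ^ N * (avg N (f p q) (?s i j) - avg N (f p q) 0))
      (cmod (2 ^ N) * op_norm n (\<lambda>i j. ?s i j - 0))"
    by (rule block_bound_cmult)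
  moreover have "cmod (2 ^ N) * op_norm n (\<lambda>i j. ?s i j - 0) \<le> op_norm n y"
  proof -
    have "op_norm n (\<lambda>i j. ?s i j - 0) \<le> cmod (complex_of_real ((1/2) ^ N)) * op_norm n y"
      using op_norm_scaleC [of n "complex_of_real ((1/2) ^ N)" y]
      by (simp only: scaleR_blinfun_scaleC add_0_left diff_0_right)
    from mult_left_mono [OF this, of "cmod (2 ^ N)"] show ?thesis
      by (simp add: norm_power power_divide norm_divide)
  qed
  ultimately show ?thesis
    unfolding quotient_def by (rule block_bound_mono)
qed

lemma block_bound_lift:
  assumes "n_lipschitz 1 n X m f" "f \<in> mats m (Lip0 X)" "y \<in> mats n X"
  shows "block_bound n m (\<lambda>i j p q. lift (y i j) (f p q)) (op_norm n y)"
proof (rule block_bound_limit [OF block_bound_quotient [OF assms(1,3)]])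
  fix i j p q assume "i < n" "j < n" "p < m" "q < m"
  then have "f p q \<in> Lip0 X" "y i j \<in> X"
    using assms(2,3) by (auto simp: mats_def)
  then show "(\<lambda>N. quotient N 0 (y i j) (f p q)) \<longlonglongrightarrow> lift (y i j) (f p q)"
    using quotient_tendsto_lift by (auto simp: Lip0_def)
qed

text \<open>The complex-linear part of the real-linear map \<open>lift\<close>.\<close>

definition complex_lift :: "('h \<Rightarrow>\<^sub>L 'h) \<Rightarrow> (('h \<Rightarrow>\<^sub>L 'h) \<Rightarrow> complex) \<Rightarrow> complex" where
  "complex_lift y = (\<lambda>f. if f \<in> Lip0 X then (lift y f - \<i> * lift (\<i> *\<^sub>C y) f) / 2 else 0)"

lemma Lip0E:
  assumes "f \<in> Lip0 X"
  obtains L where "L-lipschitz_on X f"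
  using assms by (auto simp: Lip0_def)

lemma complex_lift_clinear: "clinear_on X complex_lift"
  unfolding clinear_on_def
proof (intro conjI ballI allI)
  fix y z assume yz: "y \<in> X" "z \<in> X"
  show "complex_lift (y + z) = complex_lift y + complex_lift z"
  proof
    fix f
    show "complex_lift (y + z) f = (complex_lift y + complex_lift z) f"
    proof (cases "f \<in> Lip0 X")
      case True
      then obtain L where L: "L-lipschitz_on X f"
        by (rule Lip0E)
      show ?thesis
        using True lift_add [OF yz L] lift_add [OF scaleC_in [OF yz(1)] scaleC_in [OF yz(2)] L]
        by (simp add: complex_lift_def scaleC_blinfun_add_right field_simps)
    qed (simp add: complex_lift_def)
  qed
next
  fix c y assume y: "y \<in> X"
  show "complex_lift (c *\<^sub>C y) = c *\<^sub>C complex_lift y"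
  proof
    fix f
    show "complex_lift (c *\<^sub>C y) f = (c *\<^sub>C complex_lift y) f"
    proof (cases "f \<in> Lip0 X")
      case True
      then obtain L where L: "L-lipschitz_on X f"
        by (rule Lip0E)
      have expand: "lift (d *\<^sub>C y) f = of_real (Re d) * lift y f + of_real (Im d) * lift (\<i> *\<^sub>C y) f" for d
      proof -
        have "d *\<^sub>C y = Re d *\<^sub>R y + Im d *\<^sub>R (\<i> *\<^sub>C y)"
          unfolding scaleR_blinfun_scaleC scaleC_blinfun_assoc scaleC_blinfun_add_left [symmetric]
          by (subst complex_eq [of d]) (simp add: mult.commute)
        then show ?thesis
          using lift_add [OF scale_in scale_in L] lift_scaleR [OF _ L] y scaleC_in by simp
      qed
      have "2 * complex_lift (c *\<^sub>C y) f = lift (c *\<^sub>C y) f - \<i> * lift ((\<i> * c) *\<^sub>C y) f"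
        using True by (simp add: complex_lift_def scaleC_blinfun_assoc)
      also have "\<dots> = (of_real (Re c) + \<i> * of_real (Im c)) * (lift y f - \<i> * lift (\<i> *\<^sub>C y) f)"
        unfolding expand [of c] expand [of "\<i> * c"] by (simp add: algebra_simps)
      also have "of_real (Re c) + \<i> * of_real (Im c) = c"
        by (rule complex_eq [symmetric])
      also have "c * (lift y f - \<i> * lift (\<i> *\<^sub>C y) f) = 2 * (c *\<^sub>C complex_lift y) f"
        using True by (simp add: complex_lift_def)
      finally show ?thesis
        by simp
    qed (simp add: complex_lift_def)
  qed
qed

lemma norm_complex_lift_le:
  assumes "y \<in> X" "f \<in> Lip0 X" "L-lipschitz_on X f"
  shows "cmod (complex_lift y f) \<le> norm y * L"
proof -
  have "cmod (lift y f - \<i> * lift (\<i> *\<^sub>C y) f) \<le> cmod (lift y f) + cmod (lift (\<i> *\<^sub>C y) f)"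
    using norm_triangle_ineq4 [of "lift y f" "\<i> * lift (\<i> *\<^sub>C y) f"] by (simp add: norm_mult)
  also have "\<dots> \<le> L * norm y + L * norm (\<i> *\<^sub>C y)"
    by (intro add_mono norm_lift_le assms scaleC_in)
  finally show ?thesis
    using assms(2) by (simp add: complex_lift_def norm_divide norm_scaleC_blinfun mult.commute)
qed

lemma complex_lift_functional:
  assumes "y \<in> X"
  shows "lipschitz_functional X (complex_lift y)"
  unfolding lipschitz_functional_def
proof (intro conjI allI impI)
  show "clinear_on (Lip0 X) (complex_lift y)"
    unfolding clinear_on_def
  proof (intro conjI ballI allI)
    fix f g assume fg: "f \<in> Lip0 X" "g \<in> Lip0 X"
    then obtain L M where "L-lipschitz_on X f" "M-lipschitz_on X g"
      by (meson Lip0E)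
    then have "lift z (f + g) = lift z f + lift z g" if "z \<in> X" for z
      unfolding plus_fun_def by (rule lift_add_function [OF that])
    then show "complex_lift y (f + g) = complex_lift y f + complex_lift y g"
      using fg assms scaleC_in [OF assms] by (simp add: complex_lift_def Lip0_add field_simps)
  next
    fix c f assume f: "f \<in> Lip0 X"
    then obtain L where "L-lipschitz_on X f"
      by (rule Lip0E)
    then have "lift z (c *\<^sub>C f) = c * lift z f" if "z \<in> X" for z
      unfolding scaleC_fun_def scaleC_complex_def by (rule lift_cmult_function [OF that])
    then show "complex_lift y (c *\<^sub>C f) = c *\<^sub>C complex_lift y f"
      using f assms scaleC_in [OF assms]
      by (simp add: complex_lift_def Lip0_scaleC scaleC_complex_def algebra_simps)
  qed
  show "complex_lift y f = 0" if "f \<notin> Lip0 X" for f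
    using that by (simp add: complex_lift_def)
  show "\<exists>C\<ge>0. \<forall>f\<in>Lip0 X. \<forall>L. L-lipschitz_on X f \<longrightarrow> cmod (complex_lift y f) \<le> C * L"
    using norm_complex_lift_le [OF assms] by (intro exI [of _ "norm y"]) auto
qed

definition evaluation_avg :: "nat \<Rightarrow> ('h \<Rightarrow>\<^sub>L 'h) \<Rightarrow> (('h \<Rightarrow>\<^sub>L 'h) \<Rightarrow> complex) \<Rightarrow> complex" where
  "evaluation_avg N z = (\<lambda>f. if f \<in> Lip0 X then avg N f z else 0)"

text \<open>One more edge replaces the functional by the mean of itself and a translate.\<close>

lemma evaluation_avg_in_span:
  assumes "z \<in> X"
  shows "evaluation_avg N z \<in> evaluation_span X"
proof -
  have "F \<in> evaluation_span X"
    if "finite I" "z \<in> X" "F = (\<lambda>f. if f \<in> Lip0 X then cube_avg edge I f z else 0)"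
    for I F z
    using that
  proof (induction I arbitrary: F z)
    case empty
    then have "F = evaluation X z"
      by (simp add: evaluation_def fun_eq_iff)
    then show ?case
      using empty by (simp add: evaluation_in_span)
  next
    case (insert i I)
    let ?E = "\<lambda>z f. if f \<in> Lip0 X then cube_avg edge I f z else 0"
    have "F = (1/2) *\<^sub>C (?E z + ?E (z + edge i))"
      using insert by (auto simp: fun_eq_iff cube_avg_insert)
    moreover have "?E z \<in> evaluation_span X" "?E (z + edge i) \<in> evaluation_span X"
      using insert.IH insert.prems(1) edge_in add_in by blast+
    ultimately show ?case
      by (simp only: evaluation_span_add evaluation_span_scaleC)
  qed
  from this [of "edges N" z] show ?thesis
    using assms by (simp add: evaluation_avg_def)
qed

text \<open>Replacing \<open>lift\<close> by the quotients at late stages in the directions \<open>y\<close> and \<open>\<i> y\<close> gives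
  combinations of evaluations, close in norm to the lifting of \<open>y\<close>.\<close>

lemma complex_lift_in_free_space:
  assumes "y \<in> X" "0 < n"
  shows "complex_lift y \<in> free_space n X"
proof -
  have "\<exists>\<psi>\<in>evaluation_span X. free_mnorm n X 1 (\<lambda>_ _. complex_lift y - \<psi>) < ennreal \<epsilon>"
    if \<epsilon>: "\<epsilon> > 0" for \<epsilon>
  proof -
    have e2: "\<epsilon> / 2 > 0"
      using \<epsilon> by simp
    let ?Q = "\<lambda>N y. 2 ^ N *\<^sub>C (evaluation_avg N ((1/2) ^ N *\<^sub>R y) - evaluation_avg N 0)"
    have Q: "?Q N z f = quotient N 0 z f" if "f \<in> Lip0 X" for N z f
      using that by (simp add: quotient_def evaluation_avg_def)
    have Q_in: "?Q N z \<in> evaluation_span X" if "z \<in> X" for N z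
      by (intro evaluation_span_scaleC evaluation_span_diff evaluation_avg_in_span scale_in zero_in that)
    obtain N where N: "\<And>f L. L-lipschitz_on X f \<Longrightarrow> norm (lift y f - quotient N 0 y f) \<le> \<epsilon> / 2 * L"
      using quotient_approximates_lift [OF assms(1) e2] by blast
    obtain M where M: "\<And>f L. L-lipschitz_on X f \<Longrightarrow>
        norm (lift (\<i> *\<^sub>C y) f - quotient M 0 (\<i> *\<^sub>C y) f) \<le> \<epsilon> / 2 * L"
      using quotient_approximates_lift [OF scaleC_in [OF assms(1)] e2] by blast
    define \<psi> where "\<psi> = (1/2) *\<^sub>C (?Q N y - \<i> *\<^sub>C ?Q M (\<i> *\<^sub>C y))"
    have \<psi>: "\<psi> \<in> evaluation_span X"
      unfolding \<psi>_def
      by (intro evaluation_span_scaleC [of _ _ "1/2"] evaluation_span_scaleC [of _ _ "\<i>"]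
          evaluation_span_diff [of _ _ "\<i> *\<^sub>C _"] Q_in scaleC_in assms(1))
    have "free_mnorm n X 1 (\<lambda>_ _. complex_lift y - \<psi>) \<le> ennreal (\<epsilon> / 2)"
    proof (rule free_mnorm_le)
      show "clinear_on (Lip0 X) (complex_lift y - \<psi>)"
        using lipschitz_functional_diff [OF complex_lift_functional [OF assms(1)]
            lipschitz_functional_span [OF \<psi> zero_in]]
        by (simp add: lipschitz_functional_def)
      fix f L assume f: "f \<in> Lip0 X" "L-lipschitz_on X f"
      have \<psi>f: "\<psi> f = (quotient N 0 y f - \<i> * quotient M 0 (\<i> *\<^sub>C y) f) / 2"
        unfolding \<psi>_def using Q [OF f(1)] by simp
      have "(complex_lift y - \<psi>) f = ((lift y f - quotient N 0 y f)
          - \<i> * (lift (\<i> *\<^sub>C y) f - quotient M 0 (\<i> *\<^sub>C y) f)) / 2"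
        unfolding minus_apply \<psi>f using f(1) by (simp add: complex_lift_def field_simps)
      also have "cmod \<dots> \<le> (cmod (lift y f - quotient N 0 y f)
          + cmod (lift (\<i> *\<^sub>C y) f - quotient M 0 (\<i> *\<^sub>C y) f)) / 2"
        using norm_triangle_ineq4 [of "lift y f - quotient N 0 y f"
            "\<i> * (lift (\<i> *\<^sub>C y) f - quotient M 0 (\<i> *\<^sub>C y) f)"]
        by (simp add: norm_divide norm_mult)
      also have "\<dots> \<le> \<epsilon> / 2 * L"
        using N [OF f(2)] M [OF f(2)] by simp
      finally show "cmod ((complex_lift y - \<psi>) f) \<le> \<epsilon> / 2 * L" .
    qed (use e2 assms zero_in in auto)
    also have "\<dots> < ennreal \<epsilon>"
      using \<epsilon> by (simp add: ennreal_less_iff)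
    finally show ?thesis
      using \<psi> by blast
  qed
  then show ?thesis
    using lipschitz_functional_in_dual [OF complex_lift_functional [OF assms(1)] assms(2) zero_in]
    unfolding free_space_def by simp
qed

text \<open>Averages inherit the bound \<open>Lip\<^sub>n \<le> 1\<close>, so the quotients satisfy the estimate at every stage
  and their limit does too; multiplication by \<open>\<i>\<close> preserves the norms of matrices of operators.\<close>

lemma complex_lift_n_contraction: "n_contraction X op_mnorm (free_mnorm n X) n complex_lift"
  unfolding n_contraction_def
proof (intro conjI complex_lift_clinear ballI)
  fix y assume y: "y \<in> mats n X"
  show "free_mnorm n X n (\<lambda>i j. complex_lift (y i j)) \<le> op_mnorm n y"
    unfolding free_mnorm_def dual_mnorm_def op_mnorm_def
  proof (intro SUP_least)
    fix m e assume "e \<in> {e \<in> mats m (Lip0 X). Lip_mnorm n X m e \<le> 1}"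
    then have e: "e \<in> mats m (Lip0 X)" and lip: "n_lipschitz 1 n X m e"
      using Lip_mnorm_le_iff [of 1 n X m e] by auto
    have iy: "(\<lambda>i j. \<i> *\<^sub>C y i j) \<in> mats n X"
      using y scaleC_in by (auto simp: mats_def)
    have "block_bound n m (\<lambda>i j p q. 1/2 * lift (y i j) (e p q) + (- \<i> / 2) * lift (\<i> *\<^sub>C y i j) (e p q))
        (cmod (1/2) * op_norm n y + cmod (- \<i> / 2) * op_norm n (\<lambda>i j. \<i> *\<^sub>C y i j))"
      by (intro block_bound_add block_bound_cmult block_bound_lift [OF lip e] y
          block_bound_lift [OF lip e iy])
    moreover have "cmod (1/2) * op_norm n y + cmod (- \<i> / 2) * op_norm n (\<lambda>i j. \<i> *\<^sub>C y i j) \<le> op_norm n y"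
      using op_norm_scaleC [of n \<i> y] by (simp add: norm_divide)
    ultimately have "block_bound n m
        (\<lambda>i j p q. 1/2 * lift (y i j) (e p q) + (- \<i> / 2) * lift (\<i> *\<^sub>C y i j) (e p q)) (op_norm n y)"
      by (rule block_bound_mono)
    also have "?this \<longleftrightarrow> block_bound n m (\<lambda>i j p q. complex_lift (y i j) (e p q)) (op_norm n y)"
      using e by (intro block_bound_cong) (auto simp: complex_lift_def mats_def diff_divide_distrib)
    finally have "block_bound m n (\<lambda>i j p q. complex_lift (y p q) (e i j)) (op_norm n y)"
      by (rule block_bound_swap)
    then show "ennreal (block_norm m n (\<lambda>i j p q. complex_lift (y p q) (e i j))) \<le> ennreal (op_norm n y)"
      by (simp add: block_norm_le_iff op_norm_nonneg ennreal_leI)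
  qed
qed

text \<open>Coefficient functions are complex-linear on \<open>X\<close>, hence both halves of the lifting contribute
  \<open>\<langle>y h, k\<rangle>/2\<close>.\<close>

lemma complex_lift_barycentre:
  assumes "y \<in> X"
  shows "barycentre X (complex_lift y) y"
  unfolding barycentre_def
proof (intro conjI allI impI assms)
  fix h k
  let ?g = "coefficient X h k"
  have lift: "lift z ?g = cinner (z h) k" if "z \<in> X" for z
  proof -
    have "lift z ?g = ?g z"
      by (rule lift_of_linear [OF _ _ that])
        (auto simp: coefficient_def add_in scale_in plus_blinfun.rep_eq cinner_add_left
          scaleR_blinfun.rep_eq scaleR_scaleC cinner_scaleC_left)
    then show ?thesis
      using that by (simp add: coefficient_def)
  qed
  show "cinner (y h) k = complex_lift y ?g"
    using coefficient_in_Lip0 [OF zero_in] lift [OF assms] lift [OF scaleC_in [OF assms]]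
    by (simp add: complex_lift_def scaleC_blinfun.rep_eq cinner_scaleC_left)
qed

end

theorem theorem4p5:
  fixes X :: "('h::complex_hilbert \<Rightarrow>\<^sub>L 'h) set" and n :: nat
  assumes "operator_space X"
    and "separable_space (top_of_set X)"
    and "n \<ge> 1"
  shows "isometric_Lipschitz_lifting n X"
proof -
  obtain x where "dyadic_cube X x"
    using exists_dyadic_cube [OF subspace_operator_space [OF assms(1)] assms(2)] by blast
  then interpret operator_space_cube X x
    by (intro operator_space_cube.intro operator_space_cube_axioms.intro assms(1))
  have n: "0 < n"
    using assms(3) by simp
  have in_free: "complex_lift y \<in> free_space n X" if "y \<in> X" for y
    by (rule complex_lift_in_free_space [OF that n])
  have "beta n X (complex_lift y) = y" if "y \<in> X" for y
    by (rule barycentre_unique [OF barycentre_beta [OF assms(1) n in_free [OF that]]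
          complex_lift_barycentre [OF that]])
  then show ?thesis
    unfolding isometric_Lipschitz_lifting_def
    using in_free complex_lift_n_contraction by blast
qed

end
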